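(* There is a constant amortized time (CAT) algorithm which, given integers $n\ge 1$ and $0\le k\le\frac{n(n-1)}{2}$, generates all permutations in $\mathfrak{S}_n$ with major index equal to $k$, each exactly once, in an order in which two consecutive generated permutations $\sigma,\tau$ differ by at most three transpositions (i.e. $\tau=\sigma\cdot\theta_1\cdots\theta_m$ with $m\le 3$ and $\theta_1,\ldots,\theta_m$ transpositions). That is, there is an absolute constant $C$ such that, for all such $n,k$, the total number of elementary operations performed is at most $C\,(N+n^2)$, where $N$ is the number of permutations in $\mathfrak{S}_n$ with major index $k$.
   Context: $\mathfrak{S}_n$ is the set of permutations of $\{1,\ldots,n\}$, with product $(\sigma\cdot\tau)(i)=\sigma(\tau(i))$. The major index of $\pi\in\mathfrak{S}_n$ is the sum of all $i$, $1\le i<n$, with $\pi_i>\pi_{i+1}$. Operations are counted in the unit-cost random access model (arithmetic, comparisons and array accesses on integers of size polynomial in $n$ cost one). The current permutation is stored in an array modified in place; "generating" a permutation means that the array contains it at a designated output instant, and the cost of printing the array is not counted. The term $n^2$ accounts for the pre-processing (tabulating functions such as $x\mapsto\min\{s:\frac{s(s-1)}{2}\ge x\}$ for $x\le\frac{n(n-1)}{2}$) and the initialization of the first permutation. *)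

theory Defs
  imports "HOL-Combinatorics.Permutations"
begin

section \<open>Permutations and major index\<close>

definition maj :: "nat \<Rightarrow> (nat \<Rightarrow> nat) \<Rightarrow> nat" where
  "maj n \<pi> = \<Sum> {i \<in> {1..<n}. \<pi> i > \<pi> (i + 1)}"

definition perms_maj :: "nat \<Rightarrow> nat \<Rightarrow> (nat \<Rightarrow> nat) set" where
  "perms_maj n k = {\<pi>. \<pi> permutes {1..n} \<and> maj n \<pi> = k}"

definition is_transposition :: "nat \<Rightarrow> (nat \<Rightarrow> nat) \<Rightarrow> bool" where
  "is_transposition n \<theta> \<longleftrightarrow>
     (\<exists>i\<in>{1..n}. \<exists>j\<in>{1..n}. i \<noteq> j \<and> \<theta> = Transposition.transpose i j)"

definition differ_by_transpositions :: "nat \<Rightarrow> nat \<Rightarrow> (nat \<Rightarrow> nat) \<Rightarrow> (nat \<Rightarrow> nat) \<Rightarrow> bool" where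
  "differ_by_transpositions n r \<sigma> \<tau> \<longleftrightarrow>
     (\<exists>\<theta>s. length \<theta>s \<le> r \<and> (\<forall>\<theta>\<in>set \<theta>s. is_transposition n \<theta>) \<and> \<tau> = foldl (\<circ>) \<sigma> \<theta>s)"


section \<open>Unit-cost random access programs\<close>

text \<open>
  Programs are structured programs over integer registers and integer arrays, both named by
  natural numbers; a program text mentions only finitely many of them. Conditions are
  arithmetic expressions, with 0 as false; comparisons return 0 or 1.
\<close>

datatype binop = Add | Sub | Mul | Div | Mod | Less | Equal

datatype expr =
    Const int
  | Reg nat
  | Read nat expr
  | Bin binop expr expr

datatype com =
    Skip
  | Assign nat expr
  | Store nat expr expr
  | Seq com com
  | Cond expr com com
  | While expr com
  | Output

record state =
  regs :: "nat \<Rightarrow> int"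
  arrs :: "nat \<Rightarrow> nat \<Rightarrow> int"

fun binop_val :: "binop \<Rightarrow> int \<Rightarrow> int \<Rightarrow> int option" where
  "binop_val Add x y = Some (x + y)"
| "binop_val Sub x y = Some (x - y)"
| "binop_val Mul x y = Some (x * y)"
| "binop_val Div x y = (if y = 0 then None else Some (x div y))"
| "binop_val Mod x y = (if y = 0 then None else Some (x mod y))"
| "binop_val Less x y = Some (if x < y then 1 else 0)"
| "binop_val Equal x y = Some (if x = y then 1 else 0)"

definition fits :: "int \<Rightarrow> int \<Rightarrow> int option" where
  "fits B v = (if \<bar>v\<bar> \<le> B then Some v else None)"

text \<open>
  The parameter \<open>B\<close> is the largest absolute value that a memory cell can hold. Evaluation is
  undefined as soon as any intermediate value exceeds it, or on a division by zero or a negative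
  array index.
\<close>

fun eval :: "int \<Rightarrow> state \<Rightarrow> expr \<Rightarrow> int option" where
  "eval B s (Const c) = fits B c"
| "eval B s (Reg x) = fits B (regs s x)"
| "eval B s (Read a e) =
     Option.bind (eval B s e) (\<lambda>i. if i < 0 then None else fits B (arrs s a (nat i)))"
| "eval B s (Bin f e1 e2) =
     Option.bind (eval B s e1) (\<lambda>x. Option.bind (eval B s e2) (\<lambda>y.
       Option.bind (binop_val f x y) (fits B)))"

text \<open>Every register, constant and array access and every operator costs one.\<close>

fun ecost :: "expr \<Rightarrow> nat" where
  "ecost (Const c) = 1"
| "ecost (Reg x) = 1"
| "ecost (Read a e) = 1 + ecost e"
| "ecost (Bin f e1 e2) = 1 + ecost e1 + ecost e2"

definition set_reg :: "nat \<Rightarrow> int \<Rightarrow> state \<Rightarrow> state" where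
  "set_reg x v s = s\<lparr>regs := (regs s)(x := v)\<rparr>"

definition set_cell :: "nat \<Rightarrow> nat \<Rightarrow> int \<Rightarrow> state \<Rightarrow> state" where
  "set_cell a i v s = s\<lparr>arrs := (arrs s)(a := (arrs s a)(i := v))\<rparr>"

text \<open>
  \<open>exec B c s t out m\<close>: with cell bound \<open>B\<close>, the program \<open>c\<close> started in \<open>s\<close> halts in \<open>t\<close> after
  \<open>m\<close> elementary operations; \<open>out\<close> lists the contents of array 0 (which holds the current
  permutation) at the successive output instants. Runs in which an evaluation is undefined
  have no derivation.
\<close>

inductive exec ::
  "int \<Rightarrow> com \<Rightarrow> state \<Rightarrow> state \<Rightarrow> (nat \<Rightarrow> int) list \<Rightarrow> nat \<Rightarrow> bool" for B :: int where
  Skip: "exec B Skip s s [] 1"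
| Assign: "eval B s e = Some v \<Longrightarrow> exec B (Assign x e) s (set_reg x v s) [] (1 + ecost e)"
| Store: "eval B s e1 = Some i \<Longrightarrow> 0 \<le> i \<Longrightarrow> eval B s e2 = Some v \<Longrightarrow>
    exec B (Store a e1 e2) s (set_cell a (nat i) v s) [] (1 + ecost e1 + ecost e2)"
| Seq: "exec B c1 s s' out1 m1 \<Longrightarrow> exec B c2 s' t out2 m2 \<Longrightarrow>
    exec B (Seq c1 c2) s t (out1 @ out2) (m1 + m2)"
| CondTrue: "eval B s e = Some v \<Longrightarrow> v \<noteq> 0 \<Longrightarrow> exec B c1 s t out m \<Longrightarrow>
    exec B (Cond e c1 c2) s t out (1 + ecost e + m)"
| CondFalse: "eval B s e = Some 0 \<Longrightarrow> exec B c2 s t out m \<Longrightarrow>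
    exec B (Cond e c1 c2) s t out (1 + ecost e + m)"
| WhileFalse: "eval B s e = Some 0 \<Longrightarrow> exec B (While e c) s s [] (1 + ecost e)"
| WhileTrue: "eval B s e = Some v \<Longrightarrow> v \<noteq> 0 \<Longrightarrow> exec B c s s' out1 m1 \<Longrightarrow>
    exec B (While e c) s' t out2 m2 \<Longrightarrow>
    exec B (While e c) s t (out1 @ out2) (1 + ecost e + m1 + m2)"
| Output: "exec B Output s s [arrs s 0] 1"

inductive_cases exec_SkipE: "exec B Skip s t out m"
inductive_cases exec_AssignE: "exec B (Assign x e) s t out m"
inductive_cases exec_StoreE: "exec B (Store a e1 e2) s t out m"
inductive_cases exec_SeqE: "exec B (Seq c1 c2) s t out m"
inductive_cases exec_CondE: "exec B (Cond e c1 c2) s t out m"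
inductive_cases exec_WhileE: "exec B (While e c) s t out m"
inductive_cases exec_OutputE: "exec B Output s t out m"

lemma exec_deterministic:
  assumes "exec B c s t out m" and "exec B c s t' out' m'"
  shows "t' = t \<and> out' = out \<and> m' = m"
  using assms
proof (induction arbitrary: t' out' m' rule: exec.induct)
  case (Skip s)
  then show ?case by (rule exec_SkipE) simp
next
  case (Assign s e v x)
  from Assign.prems show ?case by (rule exec_AssignE) (simp add: Assign.hyps)
next
  case (Store s e1 i e2 v a)
  from Store.prems show ?case by (rule exec_StoreE) (simp add: Store.hyps)
next
  case (Seq c1 s s' out1 m1 c2 t out2 m2)
  from Seq.prems show ?case
  proof (rule exec_SeqE)
    fix u o1 n1 o2 n2
    assume run: "out' = o1 @ o2" "m' = n1 + n2" "exec B c1 s u o1 n1" "exec B c2 u t' o2 n2"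
    from Seq.IH(1)[OF run(3)] Seq.IH(2) run show ?case by metis
  qed
next
  case (CondTrue s e v c1 t out m c2)
  from CondTrue.prems show ?case
  proof (rule exec_CondE)
    fix n1 assume "m' = Suc (ecost e + n1)" "exec B c1 s t' out' n1"
    with CondTrue.IH show ?case by (metis plus_1_eq_Suc add_Suc)
  qed (use CondTrue.hyps in simp)
next
  case (CondFalse s e c2 t out m c1)
  from CondFalse.prems show ?case
  proof (rule exec_CondE)
    fix n1 assume "m' = Suc (ecost e + n1)" "exec B c2 s t' out' n1"
    with CondFalse.IH show ?case by (metis plus_1_eq_Suc add_Suc)
  qed (use CondFalse.hyps in simp)
next
  case (WhileFalse s e c)
  from WhileFalse.prems show ?case by (rule exec_WhileE) (simp_all add: WhileFalse.hyps)
next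
  case (WhileTrue s e v c s' out1 m1 t out2 m2)
  from WhileTrue.prems show ?case
  proof (rule exec_WhileE)
    fix w u o1 n1 o2 n2
    assume run: "out' = o1 @ o2" "m' = Suc (ecost e + n1 + n2)"
      "exec B c s u o1 n1" "exec B (While e c) u t' o2 n2"
    have 1: "u = s' \<and> o1 = out1 \<and> n1 = m1" by (rule WhileTrue.IH(1)[OF run(3)])
    then have "exec B (While e c) s' t' o2 n2" using run(4) by simp
    then have "t' = t \<and> o2 = out2 \<and> n2 = m2" by (rule WhileTrue.IH(2))
    with 1 show ?case by (simp add: run(1,2))
  qed (use WhileTrue.hyps in simp)
next
  case (Output s)
  then show ?case by (rule exec_OutputE) simp
qed

text \<open>The inputs are in registers 0 and 1; all other memory is zero.\<close>

definition init_state :: "nat \<Rightarrow> nat \<Rightarrow> state" where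
  "init_state n k = \<lparr>regs = (\<lambda>_. 0)(0 := int n, 1 := int k), arrs = (\<lambda>_ _. 0)\<rparr>"

definition stores_perm :: "nat \<Rightarrow> (nat \<Rightarrow> int) \<Rightarrow> (nat \<Rightarrow> nat) \<Rightarrow> bool" where
  "stores_perm n A \<pi> \<longleftrightarrow> (\<forall>i\<in>{1..n}. A i = int (\<pi> i))"

definition generates ::
  "int \<Rightarrow> com \<Rightarrow> nat \<Rightarrow> nat \<Rightarrow> (nat \<Rightarrow> nat) list \<Rightarrow> nat \<Rightarrow> bool" where
  "generates B P n k \<pi>s m \<longleftrightarrow>
     (\<exists>t out. exec B P (init_state n k) t out m \<and> list_all2 (stores_perm n) out \<pi>s)"

end

(* A permutation in S_n is a product of powers of the cyclic value shifts rot m (v -> v - 1 modulo m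
   on {1..m}), and its major index is the sum of the exponents x_1, ..., x_n with 0 <= x_i < i. Moving
   one unit between the neighbouring exponents x_(l-1) and x_l multiplies the permutation by a single
   transposition. So the codes of sum k form a tree whose edges are transpositions: the parent of a code
   is obtained by moving a unit one place to the left from the first nonzero entry that is neither in
   the maximal prefix with x_i = i - 1 nor the entry directly behind that prefix. Every code has at most
   three children, and on such an edge the places to be exchanged have a closed form in the prefix
   length and the entry behind it, so that a depth-first walk costs O(1) per step.

   The walk outputs a code on entering it at even depth and on leaving it at odd depth; consecutive
   outputs are then at distance at most 3 in the tree (Sekanina's cube of a tree). *)
theory Submission
  imports Defs
begin

section \<open>Codes for the major index\<close>

text \<open>The cost model dictates the parent rule. On an edge that moves a unit from place
  \<open>l\<close> of a code \<open>y\<close>, one of the exchanged places is \<open>l\<close>, the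
  other is where \<open>decode (l - 1) y\<close> takes the value 1; for a general code that place
  would have to be searched for. If \<open>l\<close> is the first nonzero entry behind the full
  prefix and its neighbour, only zeros lie in between, so \<open>decode (l - 1) y\<close> is the
  reversal of an initial segment followed by a single cyclic shift, and the place is a difference of
  two numbers. Every move to the left lowers the sum of i * x_i by one, so moves to the parent end,
  and they can only end in a code with nothing behind the prefix and its neighbour. Such a code is
  the greedy decomposition of k into 0 + 1 + ... + N and a remainder, hence the root is unique. The
  walk keeps no stack: both the parent and the index of a code among its siblings are functions of
  the code. What a step cannot afford is to search for the next nonzero entry, which may be far
  away; this is why the nonzero entries are chained by links.\<close>

definition rot :: "nat \<Rightarrow> nat \<Rightarrow> nat" where
  "rot m v = (if v = 1 then m else if v \<in> {2..m} then v - 1 else v)"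

primrec decode :: "nat \<Rightarrow> (nat \<Rightarrow> nat) \<Rightarrow> nat \<Rightarrow> nat" where
  "decode 0 x = id"
| "decode (Suc m) x = (rot (Suc m) ^^ x (Suc m)) \<circ> decode m x"

text \<open>The subtraction is truncated, so entries 0 and 1 are both 0. Fixing the entries beyond
  \<open>n\<close> makes \<open>decode n\<close> injective on functions.\<close>

definition codes :: "nat \<Rightarrow> nat \<Rightarrow> (nat \<Rightarrow> nat) set" where
  "codes n k = {x. (\<forall>i. x i \<le> i - 1) \<and> (\<forall>i>n. x i = 0) \<and> (\<Sum>i\<le>n. x i) = k}"

lemma rot_permutes: "0 < m \<Longrightarrow> rot m permutes {1..m}"
  by (rule bij_imp_permutes, rule bij_betw_byWitness[where f' = "\<lambda>v. if v = m then 1 else Suc v"])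
    (auto simp: rot_def)

lemma rot_pow:
  assumes "u \<le> m" "1 \<le> v" "v \<le> m"
  shows "(rot m ^^ u) v = (if u < v then v - u else v + m - u)"
  using assms by (induction u) (auto simp: rot_def)

lemma funpow_permutes: "p permutes A \<Longrightarrow> (p ^^ u) permutes A"
  by (induction u) (auto intro: permutes_compose permutes_id)

lemma decode_permutes: "decode m x permutes {1..m}"
proof (induction m)
  case (Suc m)
  have "decode m x permutes {1..Suc m}"
    using permutes_subset[OF Suc] by simp
  then show ?case
    unfolding decode.simps by (intro permutes_compose funpow_permutes rot_permutes) simp_all
qed (simp add: id_def)

lemma decode_range: "i \<in> {1..m} \<Longrightarrow> decode m x i \<in> {1..m}"
  by (rule permutes_in_image[OF decode_permutes, THEN iffD2])

lemma decode_beyond: "m < i \<Longrightarrow> decode m x i = i"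
  by (rule permutes_not_in[OF decode_permutes]) simp

lemma decode_cong: "(\<And>i. i \<le> m \<Longrightarrow> x i = y i) \<Longrightarrow> decode m x = decode m y"
  by (induction m) auto

text \<open>\<open>decode m x\<close> fixes \<open>Suc m\<close>, so the last value alone reveals
  the last exponent; codes can be peeled off from the right.\<close>

lemma decode_last:
  assumes "x (Suc m) \<le> m"
  shows "decode (Suc m) x (Suc m) = Suc m - x (Suc m)"
  using assms by (simp add: decode_beyond rot_pow)

text \<open>Lowering all values cyclically turns the value 1, at place \<open>p\<close> say, into a maximum, which moves
  the descent at \<open>p - 1\<close> (if \<open>1 < p\<close>) to \<open>p\<close>.\<close>

lemma maj_rot:
  assumes \<tau>: "\<tau> permutes {1..m}" and last: "\<tau> m \<noteq> 1" and m: "0 < m"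
  shows "maj m (rot m \<circ> \<tau>) = Suc (maj m \<tau>)"
proof -
  obtain p where p: "\<tau> p = 1" "p \<in> {1..m}"
    using permutes_surj[OF \<tau>] permutes_in_image[OF \<tau>] m
    by (metis Suc_leI atLeastAtMost_iff le_refl One_nat_def surjD)
  have pm: "p < m" using p last by (cases "p = m") auto
  have only_p: "\<tau> i = 1 \<longleftrightarrow> i = p" for i
    using permutes_inj[OF \<tau>] p(1) by (metis injD)
  have range: "1 \<le> \<tau> i \<and> \<tau> i \<le> m" if "i \<in> {1..m}" for i
    using permutes_in_image[OF \<tau>] that by simp
  have rot_eq: "rot m (\<tau> i) = (if i = p then m else \<tau> i - 1)" if "i \<in> {1..m}" for i
  proof (cases "i = p")
    case False
    then have "2 \<le> \<tau> i" "\<tau> i \<le> m"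
      using range[OF that] only_p[of i] by simp_all
    then show ?thesis using False by (simp add: rot_def)
  qed (simp add: rot_def p)
  have gt1: "1 < \<tau> i" if "i \<in> {1..m}" "i \<noteq> p" for i
    using range[OF that(1)] only_p[of i] that(2) by simp
  let ?D = "\<lambda>\<sigma>. {i \<in> {1..<m}. \<sigma> i > \<sigma> (i + 1)}"
  have desc: "i \<in> ?D (rot m \<circ> \<tau>) \<longleftrightarrow> i = p \<or> (i \<in> ?D \<tau> \<and> i + 1 \<noteq> p)" for i
  proof (cases "i \<in> {1..<m}")
    case True
    then have i: "i \<in> {1..m}" "i + 1 \<in> {1..m}" by auto
    consider "i = p" | "i + 1 = p" | "i \<noteq> p" "i + 1 \<noteq> p" by blast
    then show ?thesis
    proof cases
      case 1
      then show ?thesis using True i rot_eq[OF i(1)] rot_eq[OF i(2)] range[OF i(2)] p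
        by auto
    next
      case 2
      then show ?thesis using True i rot_eq[OF i(1)] rot_eq[OF i(2)] range[OF i(1)] p
        by auto
    next
      case 3
      then show ?thesis
        using True i rot_eq[OF i(1)] rot_eq[OF i(2)] gt1[OF i(1)] gt1[OF i(2)]
        by auto
    qed
  qed (use pm p in auto)
  have "?D (rot m \<circ> \<tau>) = insert p (?D \<tau> - {p - 1})"
  proof (rule set_eqI)
    fix i
    have "i \<in> ?D \<tau> \<Longrightarrow> i + 1 \<noteq> p \<longleftrightarrow> i \<noteq> p - 1" using p by auto
    then show "i \<in> ?D (rot m \<circ> \<tau>) \<longleftrightarrow> i \<in> insert p (?D \<tau> - {p - 1})"
      using desc[of i] by blast
  qed
  moreover have "p \<notin> ?D \<tau>"
    using p range[of "p + 1"] pm by auto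
  moreover have "finite (?D \<tau>)" by simp
  ultimately have maj': "maj m (rot m \<circ> \<tau>) = p + \<Sum> (?D \<tau> - {p - 1})"
    unfolding maj_def by (metis (lifting) DiffE finite_Diff sum.insert)
  \<comment> \<open>If \<open>p = 1\<close>, no descent is removed, but then
    \<open>p - 1 = 0\<close>, so the sum grows by one in both cases.\<close>
  have "p - 1 \<in> ?D \<tau> \<longleftrightarrow> 1 < p"
    using p pm gt1[of "p - 1"] by (cases "1 < p") (simp_all add: Suc_le_eq)
  then have "\<Sum> (?D \<tau>) = (p - 1) + \<Sum> (?D \<tau> - {p - 1})"
  proof (cases "1 < p")
    case True
    with \<open>p - 1 \<in> ?D \<tau> \<longleftrightarrow> 1 < p\<close> show ?thesis
      by (intro sum.remove[of "?D \<tau>" "p - 1" "\<lambda>i. i"]) simp_all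
  next
    case False
    then have "p - 1 \<notin> ?D \<tau>" by simp
    then have "?D \<tau> - {p - 1} = ?D \<tau>" by (rule Diff_insert0[of _ _ "{}", unfolded Diff_empty])
    then show ?thesis using False by (simp only:)
  qed
  then show ?thesis
    using p maj' unfolding maj_def by simp
qed

text \<open>At most \<open>m\<close> shifts act on values ending in \<open>Suc m\<close>. The last
  value falls by one each time and is still above 1 before each shift, so \<open>maj_rot\<close>
  applies to all of them.\<close>

lemma maj_decode:
  assumes "\<And>i. x i \<le> i - 1"
  shows "maj m (decode m x) = (\<Sum>i\<le>m. x i)"
proof (induction m)
  case 0
  then show ?case using assms[of 0] by (simp add: maj_def)
next
  case (Suc m)
  let ?\<sigma> = "decode m x"
  have \<sigma>: "?\<sigma> permutes {1..Suc m}"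
    using permutes_subset[OF decode_permutes[of m x]] by simp
  have "maj (Suc m) ((rot (Suc m) ^^ u) \<circ> ?\<sigma>) = maj (Suc m) ?\<sigma> + u" if "u \<le> m" for u
    using that
  proof (induction u)
    case (Suc u)
    have "((rot (Suc m) ^^ u) \<circ> ?\<sigma>) (Suc m) \<noteq> 1"
      using Suc.prems by (simp add: decode_beyond rot_pow)
    moreover have "(rot (Suc m) ^^ u) \<circ> ?\<sigma> permutes {1..Suc m}"
      by (intro permutes_compose[OF \<sigma>] funpow_permutes rot_permutes) simp
    ultimately show ?case
      using Suc maj_rot[of "(rot (Suc m) ^^ u) \<circ> ?\<sigma>" "Suc m"]
      by (simp add: o_def)
  qed simp
  \<comment> \<open>A largest value appended at the end creates no descent.\<close>
  moreover have "{i \<in> {1..<Suc m}. ?\<sigma> i > ?\<sigma> (i + 1)} = {i \<in> {1..<m}. ?\<sigma> i > ?\<sigma> (i + 1)}"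
  proof -
    have "\<not> ?\<sigma> m > ?\<sigma> (m + 1)" if "1 \<le> m"
      using decode_range[of m m x] that by (simp add: decode_beyond)
    then show ?thesis by (auto simp: less_Suc_eq)
  qed
  then have "maj (Suc m) ?\<sigma> = maj m ?\<sigma>" by (simp add: maj_def)
  ultimately show ?case using Suc.IH assms[of "Suc m"] by (simp add: o_def)
qed

lemma decode_inj:
  assumes "\<And>i. x i \<le> i - 1" "\<And>i. y i \<le> i - 1" "decode m x = decode m y" "i \<le> m"
  shows "x i = y i"
  using assms(3,4)
proof (induction m)
  case 0
  then show ?case using assms(1)[of 0] assms(2)[of 0] by simp
next
  case (Suc m)
  have le: "x (Suc m) \<le> m" "y (Suc m) \<le> m"
    using assms(1)[of "Suc m"] assms(2)[of "Suc m"] by simp_all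
  have eq: "x (Suc m) = y (Suc m)"
    using decode_last[of x m] decode_last[of y m] le Suc.prems(1) by (metis diff_diff_cancel le_SucI)
  have "inj (rot (Suc m) ^^ x (Suc m))"
    using permutes_inj[OF funpow_permutes[OF rot_permutes]] by blast
  then have "decode m x = decode m y"
    using Suc.prems(1) eq by (simp add: fun_eq_iff inj_eq)
  then show ?case using Suc eq by (cases "i = Suc m") simp_all
qed

text \<open>The last value dictates the exponent \<open>u\<close>. Completing the shift to a full
  turn undoes it and leaves a permutation that fixes \<open>Suc m\<close>, to which the induction
  hypothesis applies.\<close>

lemma decode_surj:
  assumes "\<pi> permutes {1..m}"
  shows "\<exists>x. (\<forall>i. x i \<le> i - 1) \<and> (\<forall>i>m. x i = 0) \<and> decode m x = \<pi>"
  using assms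
proof (induction m arbitrary: \<pi>)
  case 0
  then show ?case by (intro exI[of _ "\<lambda>_. 0"]) auto
next
  case (Suc m)
  define u where "u = Suc m - \<pi> (Suc m)"
  have last: "1 \<le> \<pi> (Suc m)" "\<pi> (Suc m) \<le> Suc m"
    using permutes_in_image[OF Suc.prems, of "Suc m"] by simp_all
  let ?R = "rot (Suc m)"
  have R: "(?R ^^ v) permutes {1..Suc m}" for v
    by (intro funpow_permutes rot_permutes) simp
  have cycle: "?R ^^ Suc m = id"
  proof
    fix v show "(?R ^^ Suc m) v = id v"
      using rot_pow[of "Suc m" "Suc m" v] permutes_not_in[OF R[of "Suc m"], of v]
      by (cases "v \<in> {1..Suc m}") auto
  qed
  define \<sigma> where "\<sigma> = (?R ^^ (Suc m - u)) \<circ> \<pi>"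
  have "\<sigma> permutes {1..Suc m}"
    unfolding \<sigma>_def by (rule permutes_compose[OF Suc.prems R])
  moreover have "\<sigma> (Suc m) = Suc m"
  proof -
    have "Suc m - u = \<pi> (Suc m)" using last by (simp add: u_def)
    then have "\<sigma> (Suc m) = (?R ^^ \<pi> (Suc m)) (\<pi> (Suc m))" by (simp only: \<sigma>_def comp_apply)
    also have "\<dots> = Suc m" by (subst rot_pow) (use last in simp_all)
    finally show ?thesis .
  qed
  then have "\<sigma> i = i" if "i \<in> {1..Suc m} - {1..m}" for i
  proof -
    have "i = Suc m" using that by auto
    with \<open>\<sigma> (Suc m) = Suc m\<close> show ?thesis by (simp only:)
  qed
  ultimately have "\<sigma> permutes {1..m}"
    by (rule permutes_superset)
  from Suc.IH[OF this] obtain x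
    where x: "\<forall>i. x i \<le> i - 1" "\<forall>i>m. x i = 0" "decode m x = \<sigma>"
    by (elim exE conjE)
  have "decode m (x(Suc m := u)) = \<sigma>"
    using x(3) by (metis decode_cong fun_upd_other not_less_eq_eq order_refl)
  moreover have "(?R ^^ u) \<circ> \<sigma> = \<pi>"
  proof -
    have "(?R ^^ u) \<circ> \<sigma> = (?R ^^ (u + (Suc m - u))) \<circ> \<pi>"
      by (simp only: \<sigma>_def comp_assoc funpow_add)
    also have "u + (Suc m - u) = Suc m" by (simp add: u_def)
    finally show ?thesis by (simp only: cycle id_comp)
  qed
  ultimately have "decode (Suc m) (x(Suc m := u)) = \<pi>" by simp
  moreover have "(x(Suc m := u)) i \<le> i - 1" for i
    using x(1) last unfolding u_def by (cases "i = Suc m") (auto simp del: One_nat_def)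
  moreover have "(x(Suc m := u)) i = 0" if "Suc m < i" for i
    using x(2) that by simp
  ultimately show ?case by blast
qed

lemma decode_bij: "bij_betw (decode n) (codes n k) (perms_maj n k)"
proof (rule bij_betw_imageI)
  show "inj_on (decode n) (codes n k)"
  proof (rule inj_onI, rule ext)
    fix x y i
    assume "x \<in> codes n k" "y \<in> codes n k" "decode n x = decode n y"
    then show "x i = y i"
      using decode_inj[of x y n i] by (cases "i \<le> n") (auto simp: codes_def)
  qed
  show "decode n ` codes n k = perms_maj n k"
  proof
    show "decode n ` codes n k \<subseteq> perms_maj n k"
      by (auto simp: perms_maj_def codes_def maj_decode intro: decode_permutes[unfolded One_nat_def])
    show "perms_maj n k \<subseteq> decode n ` codes n k"
    proof
      fix \<pi> assume \<pi>: "\<pi> \<in> perms_maj n k"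
      then obtain x where x: "\<forall>i. x i \<le> i - 1" "\<forall>i>n. x i = 0" "decode n x = \<pi>"
        using decode_surj unfolding perms_maj_def by blast
      then have "x \<in> codes n k"
        using \<pi> maj_decode[of x n] by (auto simp: codes_def perms_maj_def)
      then show "\<pi> \<in> decode n ` codes n k" using x(3) by blast
    qed
  qed
qed

section \<open>Moving a unit as a transposition of places\<close>

definition up :: "nat \<Rightarrow> (nat \<Rightarrow> nat) \<Rightarrow> nat \<Rightarrow> nat" where
  "up l x = x(l - 1 := x (l - 1) + 1, l := x l - 1)"

lemma rot_pred: "2 \<le> l \<Longrightarrow> rot (l - 1) = rot l \<circ> transpose 1 l"
  by (auto simp: fun_eq_iff rot_def transpose_def)

text \<open>Moving a unit from place \<open>l\<close> to \<open>l - 1\<close> replaces \<open>rot l\<close> by \<open>rot (l - 1)\<close>, and these two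
  cycles differ by the transposition of 1 and \<open>l\<close>; it is conjugated to places by \<open>decode (l - 1) x\<close>.\<close>

lemma decode_up:
  assumes l: "2 \<le> l" "l \<le> m" and pos: "0 < x l" and p: "decode (l - 1) x p = 1"
  shows "decode m (up l x) = decode m x \<circ> transpose p l"
  using l(2)
proof (induction m rule: dec_induct)
  case base
  define j where "j = l - 2"
  then have j: "l = Suc (Suc j)" using l(1) by simp
  let ?\<sigma> = "decode (Suc j) x"
  have prev: "decode j (up l x) = decode j x"
    by (rule decode_cong) (simp add: up_def j)
  have "decode (Suc j) (up l x) = rot (Suc j) \<circ> ?\<sigma>"
    using prev by (simp add: up_def j comp_assoc)
  then have "decode l (up l x) = (rot l ^^ (x l - 1)) \<circ> (rot l \<circ> transpose 1 l \<circ> ?\<sigma>)"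
    using rot_pred[of l] by (simp add: j up_def)
  moreover have "transpose 1 l \<circ> ?\<sigma> = ?\<sigma> \<circ> transpose p l"
  proof -
    have inj: "?\<sigma> i = ?\<sigma> i' \<longleftrightarrow> i = i'" for i i'
      by (rule inj_eq[OF permutes_inj[OF decode_permutes]])
    have "?\<sigma> p = 1" using p by (simp add: j)
    moreover have "?\<sigma> l = l" by (rule decode_beyond) (simp add: j)
    ultimately have "transpose 1 l (?\<sigma> i) = ?\<sigma> (transpose p l i)" for i
      using inj[of i p] inj[of i l] unfolding transpose_def by presburger
    then show ?thesis by (intro ext) (unfold comp_apply)
  qed
  moreover have "(rot l ^^ (x l - 1)) \<circ> rot l = rot l ^^ x l"
    using pos by (cases "x l") (simp_all only: diff_Suc_1 funpow_Suc_right less_irrefl)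
  moreover have "A \<circ> (B \<circ> C \<circ> D) = (A \<circ> B) \<circ> (C \<circ> D)" for A B C D :: "nat \<Rightarrow> nat"
    by (simp only: comp_assoc)
  ultimately have "decode l (up l x) = (rot l ^^ x l) \<circ> (?\<sigma> \<circ> transpose p l)"
    by (simp only:)
  moreover have "decode l x = (rot l ^^ x l) \<circ> ?\<sigma>"
    unfolding j decode.simps ..
  ultimately show ?case by (simp only: comp_assoc)
next
  case (step m)
  then have "up l x (Suc m) = x (Suc m)" by (simp add: up_def)
  then show ?case unfolding decode.simps step.IH by (simp only: comp_assoc)
qed

text \<open>\<open>m - 1\<close> cyclic shifts of \<open>m\<close> values are one shift backwards:
  it raises the earlier values by one and puts 1 at the end. Repeating this builds the
  reversal.\<close>

lemma decode_full:
  assumes "\<And>i. i \<le> m \<Longrightarrow> x i = i - 1" "1 \<le> j" "j \<le> m"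
  shows "decode m x j = m + 1 - j"
  using assms
proof (induction m)
  case (Suc m)
  show ?case
  proof (cases "j = Suc m")
    case True
    then show ?thesis using Suc.prems(1)[of "Suc m"] by (simp add: decode_beyond rot_pow)
  next
    case False
    then have "decode m x j = m + 1 - j" using Suc by simp
    then show ?thesis using Suc.prems False by (simp add: rot_pow)
  qed
qed simp

lemma decode_zeros:
  assumes "m \<le> m'" "\<And>i. m < i \<Longrightarrow> i \<le> m' \<Longrightarrow> x i = 0"
  shows "decode m' x = decode m x"
  using assms by (induction m' rule: dec_induct) auto

text \<open>The prefix reverses \<open>{1..f}\<close>, then the next entry shifts
  \<open>f + 1\<close> values cyclically. Modulo \<open>f + 1\<close> over the integers, one
  expression also covers \<open>j = f + 1\<close>, and the program can evaluate it.\<close>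

lemma decode_full_partial:
  assumes full: "\<And>i. i \<le> f \<Longrightarrow> x i = i - 1" and part: "x (Suc f) < f"
    and zeros: "\<And>i. Suc f < i \<Longrightarrow> i \<le> m \<Longrightarrow> x i = 0" and j: "1 \<le> j" "j \<le> Suc f" "f < m"
  shows "int (decode m x j) = (int f - int j - int (x (Suc f))) mod (int f + 1) + 1"
proof -
  have "decode m x = decode (Suc f) x"
    using j by (intro decode_zeros zeros) auto
  moreover have "decode (Suc f) x j = (rot (Suc f) ^^ x (Suc f)) (if j = Suc f then Suc f else Suc f - j)"
    using decode_full[of f x j, OF full] j by (cases "j = Suc f") (simp_all add: decode_beyond)
  moreover have "(int f - int j - int (x (Suc f))) mod (int f + 1) =
    (if f - j < x (Suc f) \<or> j = Suc f then int f - int j - int (x (Suc f)) + (int f + 1)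
     else int f - int j - int (x (Suc f)))"
  proof (cases "f - j < x (Suc f) \<or> j = Suc f")
    case True
    have "(int f - int j - int (x (Suc f))) mod (int f + 1) =
       (int f - int j - int (x (Suc f)) + (int f + 1)) mod (int f + 1)"
      by (rule mod_add_self2[symmetric])
    also have "\<dots> = int f - int j - int (x (Suc f)) + (int f + 1)"
      by (rule mod_pos_pos_trivial) (use True j part in auto)
    finally show ?thesis using True by (simp only: if_True)
  next
    case False
    then show ?thesis using j by (auto intro: mod_pos_pos_trivial)
  qed
  ultimately show ?thesis using j part by (auto simp: rot_pow)
qed

section \<open>Alternating pre- and postorder walks\<close>

text \<open>The number is fuel, as nothing bounds the depth under an arbitrary \<open>ch\<close>;
  the lemmas below ask for \<open>M < \<phi> x + m\<close>, so that it does not run out.\<close>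

primrec walk :: "('a \<Rightarrow> 'a list) \<Rightarrow> nat \<Rightarrow> bool \<Rightarrow> 'a \<Rightarrow> 'a list" where
  "walk ch 0 b x = []"
| "walk ch (Suc m) b x =
     (let ws = concat (map (walk ch m (\<not> b)) (ch x)) in if b then x # ws else ws @ [x])"

text \<open>\<open>\<phi>\<close> is the depth up to a constant: it rules out cycles and, being at
  most \<open>M\<close>, bounds the fuel.\<close>

locale rooted_tree =
  fixes S :: "'a set" and ch :: "'a \<Rightarrow> 'a list" and \<phi> :: "'a \<Rightarrow> nat" and M :: nat and root :: 'a
  assumes child_closed: "x \<in> S \<Longrightarrow> y \<in> set (ch x) \<Longrightarrow> y \<in> S"
    and child_level: "x \<in> S \<Longrightarrow> y \<in> set (ch x) \<Longrightarrow> \<phi> y = Suc (\<phi> x)"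
    and child_distinct: "x \<in> S \<Longrightarrow> distinct (ch x)"
    and child_unique: "x \<in> S \<Longrightarrow> x' \<in> S \<Longrightarrow> y \<in> set (ch x) \<Longrightarrow> y \<in> set (ch x') \<Longrightarrow> x = x'"
    and level_le: "x \<in> S \<Longrightarrow> \<phi> x \<le> M"
    and has_parent: "y \<in> S \<Longrightarrow> y \<noteq> root \<Longrightarrow> \<exists>x\<in>S. y \<in> set (ch x)"
    and root_in: "root \<in> S"
begin

definition E :: "('a \<times> 'a) set" where
  "E = {(x, y). x \<in> S \<and> y \<in> set (ch x)}"

definition near :: "nat \<Rightarrow> 'a \<Rightarrow> 'a \<Rightarrow> bool" where
  "near d x y \<longleftrightarrow> (\<exists>i\<le>d. (x, y) \<in> (E \<union> E\<inverse>) ^^ i)"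

lemma near_mono: "near i x y \<Longrightarrow> i \<le> j \<Longrightarrow> near j x y"
  unfolding near_def using order_trans by blast

lemma near_refl: "near d x x"
  unfolding near_def by (rule exI[of _ 0]) simp

lemma near_trans: "near i x y \<Longrightarrow> near j y z \<Longrightarrow> i + j \<le> d \<Longrightarrow> near d x z"
  unfolding near_def
proof (elim exE conjE)
  fix i' j'
  assume "i' \<le> i" "j' \<le> j" "i + j \<le> d" "(x, y) \<in> (E \<union> E\<inverse>) ^^ i'" "(y, z) \<in> (E \<union> E\<inverse>) ^^ j'"
  then show "\<exists>i\<le>d. (x, z) \<in> (E \<union> E\<inverse>) ^^ i"
    by (intro exI[of _ "i' + j'"]) (auto simp only: relpow_add)
qed

lemma near_child:
  assumes "x \<in> S" "y \<in> set (ch x)"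
  shows "near 1 x y" "near 1 y x"
  unfolding near_def by (rule exI[of _ 1], use assms in \<open>simp add: E_def\<close>)+

lemma level_mono: "(x, y) \<in> E\<^sup>* \<Longrightarrow> \<phi> x \<le> \<phi> y"
  by (induction rule: rtrancl_induct) (auto simp: E_def child_level)

text \<open>Parents are unique, hence so is the ancestor on a given level. This makes the subtrees
  of distinct siblings disjoint.\<close>

lemma reachable_unique:
  assumes "(x, z) \<in> E\<^sup>*" "(y, z) \<in> E\<^sup>*" "\<phi> x = \<phi> y"
  shows "x = y"
  using assms(1,2)
proof (induction rule: rtrancl_induct)
  case base
  show ?case using base
  proof (cases rule: rtranclE)
    case (step w)
    then have "\<phi> y \<le> \<phi> w" "\<phi> x = Suc (\<phi> w)"
      by (auto simp: level_mono E_def child_level)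
    then show ?thesis using assms(3) by simp
  qed simp
next
  case (step z z')
  show ?case using step.prems
  proof (cases rule: rtranclE)
    case base
    then show ?thesis
      using step(1,2) assms(3) level_mono[of x z] by (auto simp: E_def child_level)
  next
    case (step w)
    then have "w = z"
      using \<open>(z, z') \<in> E\<close> child_unique unfolding E_def by blast
    then show ?thesis using step.IH step by simp
  qed
qed

lemma set_walk: "x \<in> S \<Longrightarrow> M < \<phi> x + m \<Longrightarrow> set (walk ch m b x) = {y. (x, y) \<in> E\<^sup>*}"
proof (induction m arbitrary: x b)
  case 0
  then show ?case using level_le[of x] by simp
next
  case (Suc m)
  have "set (walk ch m (\<not> b) y) = {z. (y, z) \<in> E\<^sup>*}" if "y \<in> set (ch x)" for y
    using that Suc by (auto simp: child_closed child_level)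
  then have "set (walk ch (Suc m) b x) = {x} \<union> (\<Union>y\<in>set (ch x). {z. (y, z) \<in> E\<^sup>*})"
    by (auto simp: Let_def)
  also have "\<dots> = {y. (x, y) \<in> E\<^sup>*}"
    using Suc.prems(1)
    by (auto simp: E_def intro: converse_rtrancl_into_rtrancl elim: converse_rtranclE)
  finally show ?case .
qed

lemma distinct_walk: "x \<in> S \<Longrightarrow> M < \<phi> x + m \<Longrightarrow> distinct (walk ch m b x)"
proof (induction m arbitrary: x b)
  case (Suc m)
  have ch: "y \<in> S" "\<phi> y = Suc (\<phi> x)" "M < \<phi> y + m" if "y \<in> set (ch x)" for y
    using that Suc.prems by (auto simp: child_closed child_level)
  have "distinct (concat (map (walk ch m (\<not> b)) ys))"
    if "set ys \<subseteq> set (ch x)" "distinct ys" for ys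
    using that
  proof (induction ys)
    case (Cons y ys)
    have "set (walk ch m (\<not> b) y) \<inter> set (walk ch m (\<not> b) y') = {}" if "y' \<in> set ys" for y'
    proof -
      have "y' \<in> set (ch x)" "y \<in> set (ch x)" "y \<noteq> y'" using Cons.prems that by auto
      then show ?thesis
        using reachable_unique[of y _ y'] set_walk[OF ch(1,3)] ch(2) by auto
    qed
    moreover have "distinct (walk ch m (\<not> b) y)"
      using Suc.IH ch(1,3) Cons.prems by simp
    ultimately show ?case using Cons by auto
  qed simp
  moreover have "x \<notin> set (walk ch m (\<not> b) y)" if "y \<in> set (ch x)" for y
    using level_mono[of y x] ch[OF that] by (auto simp: set_walk)
  then have "x \<notin> set (concat (map (walk ch m (\<not> b)) (ch x)))" by auto
  moreover note child_distinct[OF Suc.prems(1)]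
  ultimately show ?case unfolding walk.simps Let_def
    by (cases b) (simp_all del: set_concat add: distinct_append)
qed simp

lemma set_walk_root:
  assumes "M < \<phi> root + m"
  shows "set (walk ch m b root) = S"
proof -
  have "(root, y) \<in> E\<^sup>*" if "y \<in> S" for y
    using that
  proof (induction "\<phi> y" arbitrary: y rule: less_induct)
    case less
    show ?case
    proof (cases "y = root")
      case False
      then obtain x where "x \<in> S" "y \<in> set (ch x)" using has_parent less.prems by blast
      then show ?thesis
        using less.hyps[of x] by (auto simp: child_level E_def intro: rtrancl_into_rtrancl)
    qed simp
  qed
  moreover have "y \<in> S" if "(root, y) \<in> E\<^sup>*" for y
    using that by (induction rule: rtrancl_induct) (auto simp: E_def root_in child_closed)
  ultimately show ?thesis using set_walk[OF root_in assms] by auto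
qed

lemma successively_concat:
  assumes "\<And>l. l \<in> set ls \<Longrightarrow> l \<noteq> [] \<and> successively P l"
    and "\<And>l l'. l \<in> set ls \<Longrightarrow> l' \<in> set ls \<Longrightarrow> P (last l) (hd l')"
  shows "successively P (concat ls)"
  using assms
proof (induction ls)
  case (Cons l ls)
  show ?case
  proof (cases ls)
    case (Cons l' ls')
    then show ?thesis using Cons.IH Cons.prems by (auto simp: successively_append_iff)
  qed (use Cons.prems in auto)
qed simp

text \<open>Children of \<open>x\<close> are visited with the opposite flag, so the list of a child begins and ends
  within distance 1 of that child, on one side in the child itself; two children are at distance 2.\<close>

lemma walk_near:
  assumes "x \<in> S" "M < \<phi> x + m"
  shows "walk ch m b x \<noteq> [] \<and> successively (near 3) (walk ch m b x) \<and>
    (if b then hd (walk ch m b x) = x \<and> near 1 (last (walk ch m b x)) x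
     else last (walk ch m b x) = x \<and> near 1 x (hd (walk ch m b x)))"
  using assms
proof (induction m arbitrary: x b)
  case 0
  then show ?case using level_le[of x] by simp
next
  case (Suc m)
  define ws where "ws = map (walk ch m (\<not> b)) (ch x)"
  have ch: "y \<in> S" "M < \<phi> y + m" "near 1 x y" "near 1 y x" if "y \<in> set (ch x)" for y
    using that Suc.prems by (auto simp: child_closed child_level near_child[unfolded One_nat_def])
  note IH = Suc.IH[OF ch(1,2), where b = "\<not> b"]
  have near_ws: "near 3 (last l) (hd l')" if "l \<in> set ws" "l' \<in> set ws" for l l'
  proof -
    from that obtain y y' where y: "y \<in> set (ch x)" "l = walk ch m (\<not> b) y"
      and y': "y' \<in> set (ch x)" "l' = walk ch m (\<not> b) y'"
      by (auto simp: ws_def)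
    have "near 2 y y'"
      by (rule near_trans[OF ch(4)[OF y(1)] ch(3)[OF y'(1)]]) simp
    \<comment> \<open>Both children are walked with the same flag, so only one of the two ends costs
      an extra step: 2 + 1 or 1 + 2.\<close>
    moreover have "(last l = y \<and> near 1 y' (hd l')) \<or> (near 1 (last l) y \<and> hd l' = y')"
      using IH[OF y(1) y(1)] IH[OF y'(1) y'(1)] y(2) y'(2) by (cases b) simp_all
    ultimately show ?thesis
      using near_trans[of 1 "last l" y 2 y' 3] near_trans[of 2 y y' 1 "hd l'" 3] by auto
  qed
  have ws: "l \<noteq> []" "successively (near 3) l" if "l \<in> set ws" for l
    using that IH by (auto simp: ws_def)
  have succ: "successively (near 3) (concat ws)"
    by (rule successively_concat) (use ws near_ws in auto)
  \<comment> \<open>With \<open>b\<close>, the list of a child ends in the child itself and may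
    begin one step away from it; without \<open>b\<close> it is the other way round.\<close>
  have hd: "near (if b then 2 else 1) x (hd l)" and last: "near (if b then 1 else 2) (last l) x"
    if "l \<in> set ws" for l
  proof -
    from that obtain y where y: "y \<in> set (ch x)" "l = walk ch m (\<not> b) y"
      by (auto simp: ws_def)
    show "near (if b then 2 else 1) x (hd l)" "near (if b then 1 else 2) (last l) x"
      using IH[OF y(1) y(1)] y(2) near_trans[OF ch(3)[OF y(1)], of 1 "hd l" 2]
        near_trans[OF _ ch(4)[OF y(1)], of 1 "last l" 2] ch(3,4)[OF y(1)]
      by (cases b; simp)+
  qed
  have ends: "concat ws \<noteq> []" "hd (concat ws) = hd (hd ws)" "last (concat ws) = last (last ws)"
    if "ws \<noteq> []"
  proof -
    show "concat ws \<noteq> []" "hd (concat ws) = hd (hd ws)"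
      using that ws by (auto simp: hd_concat neq_Nil_conv)
    have "concat ws = concat (butlast ws) @ last ws"
      using that by (metis append_butlast_last_id concat.simps concat_append append_Nil2)
    then show "last (concat ws) = last (last ws)"
      using ws[of "last ws"] that by (simp only: last_append) simp
  qed
  have walk: "walk ch (Suc m) b x = (if b then x # concat ws else concat ws @ [x])"
    by (simp add: ws_def Let_def)
  show ?case
  proof (cases "ws = []")
    case True
    then show ?thesis by (simp only: walk) (simp add: near_refl)
  next
    case False
    then have "hd ws \<in> set ws" "last ws \<in> set ws" by simp_all
    note ends = ends[OF False] and hd = hd[OF this(1)] and last = last[OF this(2)]
    show ?thesis
    proof (cases b)
      case True
      then have "near 3 x (hd (concat ws))" "near 1 (last (concat ws)) x"
        using hd last ends near_mono[of 2 x _ 3] by simp_all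
      then show ?thesis
        using True ends(1) succ unfolding walk by (simp add: successively_Cons del: concat_eq_Nil_conv)
    next
      case False
      then have "near 1 x (hd (concat ws))" "near 3 (last (concat ws)) x"
        using hd last ends near_mono[of 2 _ x 3] by simp_all
      then show ?thesis
        using False ends(1) succ unfolding walk
        by (simp add: successively_append_iff del: concat_eq_Nil_conv)
    qed
  qed
qed

end

section \<open>The tree of codes\<close>

definition dn :: "nat \<Rightarrow> (nat \<Rightarrow> nat) \<Rightarrow> nat \<Rightarrow> nat" where
  "dn l x = x(l - 1 := x (l - 1) - 1, l := x l + 1)"

definition full_upto :: "(nat \<Rightarrow> nat) \<Rightarrow> nat" where
  "full_upto x = (LEAST f. x (Suc f) \<noteq> f)"

definition next_nz :: "nat \<Rightarrow> (nat \<Rightarrow> nat) \<Rightarrow> nat \<Rightarrow> nat" where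
  "next_nz n x i = (LEAST j. i < j \<and> (0 < x j \<or> j = n + 2))"

text \<open>A missing entry is encoded as \<open>n + 2\<close>, not \<open>n + 1\<close>, because the search for \<open>first_nz\<close> starts
  behind \<open>full_upto x + 1\<close>, which can be \<open>n + 1\<close>.\<close>

definition first_nz :: "nat \<Rightarrow> (nat \<Rightarrow> nat) \<Rightarrow> nat" where
  "first_nz n x = next_nz n x (Suc (full_upto x))"

definition cand :: "nat \<Rightarrow> (nat \<Rightarrow> nat) \<Rightarrow> nat \<Rightarrow> nat" where
  "cand n x c = (if c < 2 then full_upto x + c + 1 else first_nz n x + 1)"

text \<open>The last conjunct forbids leaving a unit behind at \<open>first_nz n x\<close>: that
  place would remain the first nonzero one, and the parent move of the result would start there
  instead of at \<open>l\<close>.\<close>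

definition valid :: "nat \<Rightarrow> (nat \<Rightarrow> nat) \<Rightarrow> nat \<Rightarrow> bool" where
  "valid n x l \<longleftrightarrow> l \<le> n \<and> 0 < x (l - 1) \<and> x l < l - 1 \<and> (l = first_nz n x + 1 \<longrightarrow> x (l - 1) = 1)"

definition children :: "nat \<Rightarrow> (nat \<Rightarrow> nat) \<Rightarrow> (nat \<Rightarrow> nat) list" where
  "children n x = map (\<lambda>l. dn l x) (filter (valid n x) (map (cand n x) [0, 1, 2]))"

definition weight :: "nat \<Rightarrow> (nat \<Rightarrow> nat) \<Rightarrow> nat" where
  "weight n x = (\<Sum>i\<le>n. i * x i)"

lemma codesD:
  assumes "x \<in> codes n k"
  shows "x i \<le> i - 1" "n < i \<Longrightarrow> x i = 0" "(\<Sum>i\<le>n. x i) = k"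
  using assms by (simp_all add: codes_def)

lemma full_upto_eq: "(\<And>i. i \<le> f \<Longrightarrow> x i = i - 1) \<Longrightarrow> x (Suc f) \<noteq> f \<Longrightarrow> full_upto x = f"
  unfolding full_upto_def by (rule Least_equality) (simp, metis diff_Suc_1 not_less_eq_eq)

text \<open>The zero at place \<open>n + 1\<close> breaks the pattern, so the minimum exists; place
  1 always fits it, its entry being 0.\<close>

lemma full_upto:
  assumes "x \<in> codes n k" and n: "1 \<le> n"
  shows "i \<le> full_upto x \<Longrightarrow> x i = i - 1" "x (Suc (full_upto x)) < full_upto x"
    "1 \<le> full_upto x" "full_upto x \<le> n"
proof -
  note x = codesD[OF assms(1)]
  have last: "x (Suc n) \<noteq> n" using x(2)[of "Suc n"] n by simp
  have ne: "x (Suc (full_upto x)) \<noteq> full_upto x"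
    unfolding full_upto_def by (rule LeastI[of "\<lambda>f. x (Suc f) \<noteq> f", OF last])
  show "full_upto x \<le> n" unfolding full_upto_def by (rule Least_le[of "\<lambda>f. x (Suc f) \<noteq> f", OF last])
  show "x i = i - 1" if "i \<le> full_upto x" for i
  proof (cases i)
    case 0
    then show ?thesis using x(1)[of 0] by simp
  next
    case (Suc j)
    then show ?thesis
      using that not_less_Least[of j "\<lambda>f. x (Suc f) \<noteq> f"] by (simp add: full_upto_def)
  qed
  show less: "x (Suc (full_upto x)) < full_upto x"
    using ne x(1)[of "Suc (full_upto x)"] by simp
  then show "1 \<le> full_upto x" by simp
qed

lemma next_nz_eq:
  assumes "i < j" "j \<le> n + 2" "0 < x j \<or> j = n + 2" "\<And>m. i < m \<Longrightarrow> m < j \<Longrightarrow> x m = 0"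
  shows "next_nz n x i = j"
  unfolding next_nz_def
proof (rule Least_equality)
  fix y assume y: "i < y \<and> (0 < x y \<or> y = n + 2)"
  show "j \<le> y"
  proof (rule ccontr)
    assume "\<not> j \<le> y"
    then show False using y assms(2) assms(4)[of y] by simp
  qed
qed (use assms in simp)

lemma next_nz:
  assumes "i \<le> n + 1"
  shows "i < next_nz n x i" "next_nz n x i \<le> n + 2"
    "0 < x (next_nz n x i) \<or> next_nz n x i = n + 2"
    "i < m \<Longrightarrow> m < next_nz n x i \<Longrightarrow> x m = 0"
proof -
  let ?P = "\<lambda>j. i < j \<and> (0 < x j \<or> j = n + 2)"
  have "?P (n + 2)" using assms by simp
  then have "?P (next_nz n x i)" "next_nz n x i \<le> n + 2"
    unfolding next_nz_def by (rule LeastI, rule Least_le)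
  then show "i < next_nz n x i" "next_nz n x i \<le> n + 2"
    "0 < x (next_nz n x i) \<or> next_nz n x i = n + 2" by blast+
  show "x m = 0" if "i < m" "m < next_nz n x i"
    using not_less_Least[of m ?P] that by (simp add: next_nz_def)
qed

lemma next_nz_cong: "(\<And>j. i < j \<Longrightarrow> 0 < x j \<longleftrightarrow> 0 < y j) \<Longrightarrow> next_nz n x i = next_nz n y i"
  unfolding next_nz_def by (rule arg_cong[where f = Least]) (simp add: fun_eq_iff, blast)

lemma next_nz_Suc:
  assumes "i \<le> n" "next_nz n x i \<noteq> Suc i"
  shows "next_nz n x (Suc i) = next_nz n x i"
proof (rule next_nz_eq)
  have i: "i \<le> n + 1" using assms(1) by simp
  show "Suc i < next_nz n x i" using next_nz(1)[OF i, of x] assms(2) by simp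
  show "next_nz n x i \<le> n + 2" "0 < x (next_nz n x i) \<or> next_nz n x i = n + 2"
    by (rule next_nz[OF i])+
  show "x m = 0" if "Suc i < m" "m < next_nz n x i" for m
    using next_nz(4)[OF i _ that(2)] that(1) by simp
qed

lemma first_nz:
  assumes "x \<in> codes n k" "1 \<le> n"
  shows "full_upto x + 2 \<le> first_nz n x" "first_nz n x \<le> n \<or> first_nz n x = n + 2"
    "first_nz n x \<le> n \<Longrightarrow> 0 < x (first_nz n x)"
    "full_upto x + 2 \<le> m \<Longrightarrow> m < first_nz n x \<Longrightarrow> x m = 0"
proof -
  have f: "Suc (full_upto x) \<le> n + 1" using full_upto(4)[OF assms] by simp
  note nz = next_nz[OF f, where x = x, folded first_nz_def]
  show "full_upto x + 2 \<le> first_nz n x" using nz(1) by simp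
  show "first_nz n x \<le> n \<or> first_nz n x = n + 2"
    using nz(3) codesD(2)[OF assms(1), of "first_nz n x"] by (cases "first_nz n x \<le> n") auto
  show "first_nz n x \<le> n \<Longrightarrow> 0 < x (first_nz n x)" using nz(3) by simp
  show "full_upto x + 2 \<le> m \<Longrightarrow> m < first_nz n x \<Longrightarrow> x m = 0" using nz(4)[of m] by simp
qed

text \<open>The free weights serve twice: constant 1 shows that the sum of the code is preserved,
  the identity that \<open>weight\<close> drops by one. The additive form avoids truncated
  subtraction.\<close>

lemma up_sum:
  assumes "2 \<le> l" "l \<le> n" "0 < x l"
  shows "(\<Sum>i\<le>n. w i * up l x i) + w l = (\<Sum>i\<le>n. w i * x i) + (w (l - 1) :: nat)"
proof -
  have split: "(\<Sum>i\<le>n. h i) = h (l - 1) + (h l + (\<Sum>i\<in>{..n} - {l - 1} - {l}. h i))"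
    for h :: "nat \<Rightarrow> nat"
  proof -
    have "(\<Sum>i\<le>n. h i) = h (l - 1) + (\<Sum>i\<in>{..n} - {l - 1}. h i)"
      using assms by (intro sum.remove) auto
    also have "(\<Sum>i\<in>{..n} - {l - 1}. h i) = h l + (\<Sum>i\<in>{..n} - {l - 1} - {l}. h i)"
      using assms by (intro sum.remove) auto
    finally show ?thesis .
  qed
  have "(\<Sum>i\<in>{..n} - {l - 1} - {l}. w i * up l x i) = (\<Sum>i\<in>{..n} - {l - 1} - {l}. w i * x i)"
    by (rule sum.cong) (auto simp: up_def)
  moreover have "up l x (l - 1) = x (l - 1) + 1" "up l x l + 1 = x l"
    using assms by (auto simp: up_def)
  then have "w (l - 1) * up l x (l - 1) = w (l - 1) * x (l - 1) + w (l - 1)"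
    "w l * up l x l + w l = w l * x l"
    by (simp, metis mult.right_neutral distrib_left)
  ultimately show ?thesis using split[of "\<lambda>i. w i * up l x i"] split[of "\<lambda>i. w i * x i"] by linarith
qed

lemma up_codes:
  assumes "x \<in> codes n k" "2 \<le> l" "l \<le> n" "0 < x l" "x (l - 1) < l - 2"
  shows "up l x \<in> codes n k"
proof -
  have "(\<Sum>i\<le>n. up l x i) = k"
    using up_sum[where x = x and l = l and w = "\<lambda>_. 1", OF assms(2-4)] codesD(3)[OF assms(1)] by simp
  moreover have "up l x i \<le> i - 1" for i
    using codesD(1)[OF assms(1), of i] assms(2,5) by (auto simp: up_def)
  moreover have "up l x i = 0" if "n < i" for i
    using codesD(2)[OF assms(1) that] that assms(2,3) by (simp add: up_def)
  ultimately show ?thesis by (simp add: codes_def)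
qed

lemma up_weight: "2 \<le> l \<Longrightarrow> l \<le> n \<Longrightarrow> 0 < x l \<Longrightarrow> weight n x = Suc (weight n (up l x))"
  using up_sum[of l n x "\<lambda>i. i"] unfolding weight_def by simp

lemma up_dn: "2 \<le> l \<Longrightarrow> 0 < x (l - 1) \<Longrightarrow> up l (dn l x) = x"
  by (auto simp: up_def dn_def fun_eq_iff)

lemma dn_up: "2 \<le> l \<Longrightarrow> 0 < x l \<Longrightarrow> dn l (up l x) = x"
  by (auto simp: up_def dn_def fun_eq_iff)

lemma dn_codes:
  assumes "x \<in> codes n k" "2 \<le> l" "l \<le> n" "0 < x (l - 1)" "x l < l - 1"
  shows "dn l x \<in> codes n k"
proof -
  have "0 < dn l x l" by (simp add: dn_def)
  then have "(\<Sum>i\<le>n. dn l x i) = k"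
    using up_sum[where x = "dn l x" and l = l and w = "\<lambda>_. 1", OF assms(2,3)] codesD(3)[OF assms(1)] up_dn[of l x] assms by simp
  moreover have "dn l x i \<le> i - 1" for i
    using codesD(1)[OF assms(1), of i] assms(2,5) by (auto simp: dn_def)
  moreover have "dn l x i = 0" if "n < i" for i
    using codesD(2)[OF assms(1) that] that assms(2,3) by (simp add: dn_def)
  ultimately show ?thesis by (simp add: codes_def)
qed

lemma dn_weight:
  assumes "2 \<le> l" "l \<le> n" "0 < x (l - 1)"
  shows "weight n (dn l x) = Suc (weight n x)"
  using up_weight[OF assms(1,2), of "dn l x"] up_dn[of l x] assms by (simp add: dn_def)

text \<open>By the last claim the parent move of \<open>dn l x\<close> starts at \<open>l\<close>
  and so leads back to \<open>x\<close>: valid candidates really are children.\<close>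

lemma dn_shape:
  assumes x: "x \<in> codes n k" and n: "1 \<le> n" and c: "c < 3" and v: "valid n x (cand n x c)"
  defines "l \<equiv> cand n x c"
  shows "2 \<le> l" "dn l x \<in> codes n k" "full_upto (dn l x) = (if c = 0 then full_upto x - 1 else full_upto x)"
    "first_nz n (dn l x) = l"
proof -
  define f where "f = full_upto x"
  note full = full_upto[OF x n, folded f_def]
  note g = first_nz[OF x n, folded f_def]
  have v': "l \<le> n" "0 < x (l - 1)" "x l < l - 1" "l = first_nz n x + 1 \<Longrightarrow> x (l - 1) = 1"
    using v by (simp_all add: valid_def l_def)
  then show l2: "2 \<le> l" by simp
  show "dn l x \<in> codes n k" by (rule dn_codes[OF x l2 v'(1-3)])
  have lc: "(c = 0 \<and> l = f + 1) \<or> (c = 1 \<and> l = f + 2) \<or> (c = 2 \<and> l = first_nz n x + 1)"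
    using c by (auto simp: l_def f_def cand_def)
  show f': "full_upto (dn l x) = (if c = 0 then full_upto x - 1 else full_upto x)"
    unfolding f_def[symmetric]
  proof (cases "c = 0")
    case True
    then have l: "l = f + 1" using lc by simp
    have "full_upto (dn l x) = f - 1"
    proof (rule full_upto_eq)
      show "dn l x i = i - 1" if "i \<le> f - 1" for i
        using full(1)[of i] full(3) that by (auto simp: dn_def l)
      show "dn l x (Suc (f - 1)) \<noteq> f - 1"
        using full(1)[of f] full(3) v'(2) by (simp add: dn_def l)
    qed
    then show "full_upto (dn l x) = (if c = 0 then f - 1 else f)" using True by simp
  next
    case False
    then have l: "f + 2 \<le> l" using lc g(1) by auto
    have "full_upto (dn l x) = f"
    proof (rule full_upto_eq)
      show "dn l x i = i - 1" if "i \<le> f" for i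
        using full(1)[of i] that l by (simp add: dn_def)
      show "dn l x (Suc f) \<noteq> f"
        using full(2) l by (auto simp: dn_def)
    qed
    then show "full_upto (dn l x) = (if c = 0 then f - 1 else f)" using False by simp
  qed
  show "first_nz n (dn l x) = l"
    unfolding first_nz_def
  proof (rule next_nz_eq)
    show "Suc (full_upto (dn l x)) < l"
      using lc g(1) full(3) f' by (auto simp: f_def[symmetric])
    show "l \<le> n + 2" "0 < dn l x l \<or> l = n + 2" using v'(1) by (auto simp: dn_def)
    \<comment> \<open>For \<open>c < 2\<close> no place lies strictly between. For
      \<open>c = 2\<close> there are zeros and the place \<open>first_nz n x\<close>, whose only
      unit has just left.\<close>
    show "dn l x m = 0" if m: "Suc (full_upto (dn l x)) < m" "m < l" for m
    proof -
      have m': "Suc (if c = 0 then f - 1 else f) < m" using m(1) by (simp only: f' f_def)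
      then have l: "c = 2" "l = first_nz n x + 1" using lc m(2) by (auto split: if_splits)
      show ?thesis
      proof (cases "m = first_nz n x")
        case True
        then show ?thesis using v'(4) l by (simp add: dn_def)
      next
        case False
        then show ?thesis using g(4)[of m] m(2) m' l by (simp add: dn_def)
      qed
    qed
  qed
qed

text \<open>The index of \<open>y\<close> among the candidates for a child of its parent.\<close>

definition kind :: "nat \<Rightarrow> (nat \<Rightarrow> nat) \<Rightarrow> nat" where
  "kind n y = (if first_nz n y = full_upto y + 2
     then if y (Suc (full_upto y)) + 1 = full_upto y then 0 else 1 else 2)"

text \<open>These are the values that a return to the parent must restore. \<open>h\<close> is the
  next nonzero place of the parent from \<open>l\<close> on; \<open>l\<close> itself qualifies only
  if it held more than one unit.\<close>

lemma up_shape: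
  assumes y: "y \<in> codes n k" and n: "1 \<le> n" and le: "first_nz n y \<le> n"
  defines "l \<equiv> first_nz n y" and "f \<equiv> full_upto y"
  defines "x \<equiv> up l y" and "h \<equiv> if 1 < y l then l else next_nz n y l"
  shows "2 \<le> l" "x \<in> codes n k" "dn l x = y" "weight n y = Suc (weight n x)"
    "full_upto x = (if kind n y = 0 then f + 1 else f)"
    "first_nz n x = (if kind n y = 0 then next_nz n y l else if kind n y = 1 then h else l - 1)"
    "kind n y = 2 \<Longrightarrow> next_nz n x (l - 1) = h"
    "cand n x (kind n y) = l" "valid n x l"
proof -
  note full = full_upto[OF y n, folded f_def]
  note g = first_nz[OF y n, folded f_def l_def]
  have ln: "l \<le> n" and yl: "0 < y l" using le g(3) by (auto simp: l_def)
  show l2: "2 \<le> l" using g(1) by simp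
  \<comment> \<open>Room for the unit: place \<open>l - 1\<close> is either the first place that is
    not full or one of the zeros behind it.\<close>
  have y_prev: "y (l - 1) < l - 2"
  proof (cases "l = f + 2")
    case True
    then show ?thesis using full(2) by simp
  next
    case False
    then have "f + 2 \<le> l - 1" "l - 1 < l" using g(1) by auto
    then show ?thesis using g(4)[of "l - 1"] full(3) by simp
  qed
  show x: "x \<in> codes n k" unfolding x_def by (rule up_codes[OF y l2 ln yl y_prev])
  show dn: "dn l x = y" unfolding x_def by (rule dn_up[where x = y, OF l2 yl])
  show "weight n y = Suc (weight n x)" unfolding x_def by (rule up_weight[where x = y, OF l2 ln yl])
  have xl: "x l = y l - 1" and xp: "x (l - 1) = y (l - 1) + 1"
    and xo: "i \<noteq> l \<Longrightarrow> i \<noteq> l - 1 \<Longrightarrow> x i = y i" for i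
    using l2 by (auto simp: x_def up_def)
  have yl_le: "y l \<le> l - 1" by (rule codesD(1)[OF y])
  have beyond: "next_nz n x l = next_nz n y l"
    by (rule next_nz_cong) (use xo in auto)
  have h: "next_nz n x (l - 1) = h"
  proof (cases "1 < y l")
    case True
    then have "next_nz n x (l - 1) = l"
      using l2 ln xl by (intro next_nz_eq) auto
    then show ?thesis using True by (simp add: h_def)
  next
    case False
    then have x0: "x l = 0" using xl by simp
    have "next_nz n x (l - 1) \<noteq> Suc (l - 1)"
    proof
      assume "next_nz n x (l - 1) = Suc (l - 1)"
      moreover have "l - 1 \<le> n + 1" using ln by simp
      ultimately show False using next_nz(3)[where x = x and i = "l - 1" and n = n] x0 l2 ln by simp
    qed
    then have "next_nz n x (Suc (l - 1)) = next_nz n x (l - 1)"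
      using ln by (intro next_nz_Suc) auto
    then show ?thesis using l2 beyond False by (simp add: h_def)
  qed
  then show "kind n y = 2 \<Longrightarrow> next_nz n x (l - 1) = h" .
  have kind: "kind n y = (if l = f + 2 then if y (Suc f) + 1 = f then 0 else 1 else 2)"
    by (simp add: kind_def l_def f_def)
  show f': "full_upto x = (if kind n y = 0 then f + 1 else f)"
  proof (cases "kind n y = 0")
    case True
    then have l: "l = f + 2" "y (Suc f) + 1 = f" by (auto simp: kind split: if_splits)
    have "full_upto x = f + 1"
    proof (rule full_upto_eq)
      show "x i = i - 1" if "i \<le> f + 1" for i
        using full(1)[of i] xo[of i] xp l that by (cases "i = f + 1") auto
      show "x (Suc (f + 1)) \<noteq> f + 1" using xl yl yl_le l by simp
    qed
    then show ?thesis using True by simp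
  next
    case False
    have "full_upto x = f"
    proof (rule full_upto_eq)
      show "x i = i - 1" if "i \<le> f" for i
        using full(1)[of i] xo[of i] g(1) that by simp
      show "x (Suc f) \<noteq> f"
      proof (cases "l = f + 2")
        case True
        then show ?thesis using False xp by (auto simp: kind split: if_splits)
      next
        case False
        then show ?thesis using g(1) xo[of "Suc f"] full(2) by simp
      qed
    qed
    then show ?thesis using False by simp
  qed
  show g': "first_nz n x = (if kind n y = 0 then next_nz n y l else if kind n y = 1 then h else l - 1)"
  proof -
    consider "kind n y = 0" "l = f + 2" | "kind n y = 1" "l = f + 2" | "kind n y = 2" "f + 3 \<le> l"
      using g(1) kind by (cases "l = f + 2"; cases "y (Suc f) + 1 = f") simp_all
    then show ?thesis
    proof cases
      case 1
      then show ?thesis using f' beyond by (simp add: first_nz_def)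
    next
      case 2
      then have "Suc (full_upto x) = l - 1" using f' by simp
      then show ?thesis using 2 h by (simp add: first_nz_def)
    next
      case 3
      have "next_nz n x (Suc f) = l - 1"
      proof (rule next_nz_eq)
        show "x m = 0" if "Suc f < m" "m < l - 1" for m
          using xo[of m] g(4)[of m] that by simp
      qed (use 3 ln xp in auto)
      then show ?thesis using 3 f' by (simp add: first_nz_def)
    qed
  qed
  show "cand n x (kind n y) = l"
    using f' g' g(1) by (auto simp: kind cand_def)
  show "valid n x l"
    unfolding valid_def
  proof (intro conjI impI)
    show "l \<le> n" "0 < x (l - 1)" "x l < l - 1" using ln xp xl yl yl_le by auto
    assume lg: "l = first_nz n x + 1"
    have "full_upto x + 2 \<le> first_nz n x" by (rule first_nz(1)[OF x n])
    then have "f + 3 \<le> l" using lg f' by (auto split: if_splits)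
    then show "x (l - 1) = 1" using xp g(4)[of "l - 1"] by simp
  qed
qed

text \<open>Both codes consist of a full prefix, one partial entry and zeros. Two such codes are
  comparable place by place, so equal sums force equality.\<close>

lemma root_unique:
  assumes x: "x \<in> codes n k" and y: "y \<in> codes n k" and n: "1 \<le> n"
    and rx: "first_nz n x = n + 2" and ry: "first_nz n y = n + 2"
  shows "x = y"
proof -
  have not_before: False
    if z: "z \<in> codes n k" "first_nz n z = n + 2" and w: "w \<in> codes n k"
      and lt: "full_upto z < full_upto w \<or>
        (full_upto z = full_upto w \<and> z (Suc (full_upto z)) < w (Suc (full_upto z)))" for z w
  proof -
    let ?f = "full_upto z"
    have zf: "z (Suc ?f) < w (Suc ?f)"
      using lt full_upto(2)[OF z(1) n] full_upto(1)[OF w n, of "Suc ?f"] by auto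
    have "z i \<le> w i" if "i \<le> n" for i
    proof -
      consider "i \<le> ?f" | "i = Suc ?f" | "?f + 2 \<le> i" by linarith
      then show ?thesis
      proof cases
        case 1
        then show ?thesis using full_upto(1)[OF z(1) n] full_upto(1)[OF w n, of i] lt by auto
      next
        case 3
        then show ?thesis using first_nz(4)[OF z(1) n, of i] z(2) that by simp
      qed (use zf in simp)
    qed
    moreover have "Suc ?f \<le> n"
      using zf codesD(2)[OF w, of "Suc ?f"] by (cases "Suc ?f \<le> n") auto
    ultimately have "(\<Sum>i\<le>n. z i) < (\<Sum>i\<le>n. w i)"
      using zf by (intro sum_strict_mono_ex1) auto
    then show False using codesD(3)[OF z(1)] codesD(3)[OF w] by simp
  qed
  have f: "full_upto x = full_upto y"
    using not_before[OF x rx y] not_before[OF y ry x] by (meson linorder_neqE_nat)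
  have e: "x (Suc (full_upto x)) = y (Suc (full_upto x))"
    using not_before[OF x rx y] not_before[OF y ry x] f by (metis linorder_neqE_nat)
  show "x = y"
  proof
    fix i
    consider "i \<le> full_upto x" | "i = Suc (full_upto x)" | "full_upto x + 2 \<le> i" "i \<le> n" | "n < i"
      by linarith
    then show "x i = y i"
    proof cases
      case 1
      then show ?thesis using full_upto(1)[OF x n] full_upto(1)[OF y n] f by simp
    next
      case 3
      then show ?thesis using first_nz(4)[OF x n] first_nz(4)[OF y n] rx ry f by simp
    next
      case 4
      then show ?thesis using codesD(2)[OF x] codesD(2)[OF y] by simp
    qed (use e in simp)
  qed
qed

lemma cand_list:
  "l \<in> set (filter (valid n x) (map (cand n x) [0, 1, 2])) \<longleftrightarrow> (\<exists>c<3. l = cand n x c \<and> valid n x l)"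
proof -
  have "set [0, 1, 2] = {c :: nat. c < 3}" by auto
  then show ?thesis unfolding set_filter set_map by auto
qed

lemma children_iff:
  assumes x: "x \<in> codes n k" and n: "1 \<le> n"
  shows "y \<in> set (children n x) \<longleftrightarrow> y \<in> codes n k \<and> first_nz n y \<le> n \<and> up (first_nz n y) y = x"
proof
  assume "y \<in> set (children n x)"
  then obtain l where l: "l \<in> set (filter (valid n x) (map (cand n x) [0, 1, 2]))" "y = dn l x"
    unfolding children_def set_map by (rule imageE)
  then obtain c where c: "c < 3" "valid n x (cand n x c)" "y = dn (cand n x c) x"
    unfolding cand_list by blast
  note s = dn_shape[OF x n c(1,2)]
  have "up (cand n x c) y = x"
    unfolding c(3) using c(2) by (intro up_dn s(1)) (simp add: valid_def)
  then show "y \<in> codes n k \<and> first_nz n y \<le> n \<and> up (first_nz n y) y = x"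
    using s c by (simp add: valid_def)
next
  assume y: "y \<in> codes n k \<and> first_nz n y \<le> n \<and> up (first_nz n y) y = x"
  then have y': "y \<in> codes n k" "first_nz n y \<le> n" "up (first_nz n y) y = x" by simp_all
  note u = up_shape[OF y'(1) n y'(2), unfolded y'(3)]
  have "kind n y < 3" by (simp add: kind_def)
  then have "first_nz n y \<in> set (filter (valid n x) (map (cand n x) [0, 1, 2]))"
    unfolding cand_list using u(8,9) by metis
  then have "dn (first_nz n y) x \<in> set (children n x)"
    unfolding children_def set_map by (rule imageI)
  then show "y \<in> set (children n x)" by (simp only: u(3))
qed

lemma distinct_children:
  assumes x: "x \<in> codes n k" and n: "1 \<le> n"
  shows "distinct (children n x)"
proof -
  let ?ls = "filter (valid n x) (map (cand n x) [0, 1, 2])"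
  have "distinct ?ls"
    using first_nz(1)[OF x n] by (intro distinct_filter) (simp add: cand_def)
  moreover have "inj_on (\<lambda>l. dn l x) (set ?ls)"
  proof (rule inj_onI)
    fix l l' assume l: "l \<in> set ?ls" "l' \<in> set ?ls" and eq: "dn l x = dn l' x"
    have "first_nz n (dn l x) = l" if "l \<in> set ?ls" for l
    proof -
      from that obtain c where "c < 3" "l = cand n x c" "valid n x (cand n x c)"
        unfolding cand_list by blast
      then show ?thesis using dn_shape(4)[OF x n] by simp
    qed
    then show "l = l'" using l eq by metis
  qed
  ultimately show ?thesis unfolding children_def by (simp only: distinct_map)
qed

lemma weight_le:
  assumes "x \<in> codes n k"
  shows "weight n x \<le> n * k"
proof -
  have "weight n x \<le> (\<Sum>i\<le>n. n * x i)" unfolding weight_def by (rule sum_mono) simp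
  then show ?thesis using codesD(3)[OF assms] by (simp add: sum_distrib_left[symmetric])
qed

lemma rooted_tree_codes:
  assumes r: "r \<in> codes n k" "first_nz n r = n + 2" and n: "1 \<le> n"
  shows "rooted_tree (codes n k) (children n) (weight n) (n * k) r"
proof
  fix x y assume x: "x \<in> codes n k" and y: "y \<in> set (children n x)"
  then have y': "y \<in> codes n k" "first_nz n y \<le> n" "up (first_nz n y) y = x"
    by (simp_all add: children_iff[OF x n])
  show "y \<in> codes n k" by fact
  show "weight n y = Suc (weight n x)" using up_shape(4)[OF y'(1) n y'(2)] y'(3) by simp
next
  fix x assume x: "x \<in> codes n k"
  show "distinct (children n x)" by (rule distinct_children[OF x n])
  show "weight n x \<le> n * k" by (rule weight_le[OF x])
next
  fix x x' y
  assume "x \<in> codes n k" "x' \<in> codes n k" "y \<in> set (children n x)" "y \<in> set (children n x')"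
  then have "up (first_nz n y) y = x" "up (first_nz n y) y = x'"
    by (simp_all add: children_iff[OF _ n, where k = k])
  then show "x = x'" by (simp only:)
next
  fix y assume y: "y \<in> codes n k" and ne: "y \<noteq> r"
  then have "first_nz n y \<noteq> n + 2" using root_unique[OF y r(1) n _ r(2)] by blast
  then have le: "first_nz n y \<le> n" using first_nz(2)[OF y n] by simp
  have x: "up (first_nz n y) y \<in> codes n k" by (rule up_shape(2)[OF y n le])
  show "\<exists>x\<in>codes n k. y \<in> set (children n x)"
    by (rule bexI[OF _ x]) (use children_iff[OF x n, of y] y le in simp)
qed (rule r)

section \<open>Tree edges as transpositions, and the resulting order of the permutations\<close>

definition pos :: "(nat \<Rightarrow> nat) \<Rightarrow> nat" where
  "pos y = full_upto y - y (Suc (full_upto y))"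

text \<open>All entries between the neighbour of the prefix and \<open>first_nz n y\<close> vanish,
  so \<open>decode_full_partial\<close> describes \<open>decode (first_nz n y - 1) y\<close>. Its
  value is 1 where the offset is 0, and solving for that place gives \<open>pos y\<close>.\<close>

lemma decode_parent:
  assumes y: "y \<in> codes n k" and n: "1 \<le> n" and le: "first_nz n y \<le> n"
  shows "1 \<le> pos y" "pos y < first_nz n y"
    "decode n (up (first_nz n y) y) = decode n y \<circ> transpose (pos y) (first_nz n y)"
proof -
  let ?f = "full_upto y" and ?l = "first_nz n y"
  note full = full_upto[OF y n] and g = first_nz[OF y n]
  show p: "1 \<le> pos y" "pos y < ?l" using full(2,3) g(1) by (simp_all add: pos_def)
  have "int (decode (?l - 1) y (pos y)) = (int ?f - int (pos y) - int (y (Suc ?f))) mod (int ?f + 1) + 1"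
  proof (rule decode_full_partial)
    show "y i = 0" if "Suc ?f < i" "i \<le> ?l - 1" for i
      using g(4)[of i] that g(1) by simp
  qed (use full g(1) p in \<open>simp_all add: pos_def\<close>)
  also have "int ?f - int (pos y) - int (y (Suc ?f)) = 0"
    using full(2) by (simp add: pos_def)
  finally have "decode (?l - 1) y (pos y) = 1" by simp
  then show "decode n (up ?l y) = decode n y \<circ> transpose (pos y) ?l"
    using g(1) g(3)[OF le] le by (intro decode_up) simp_all
qed

lemma near_transpositions:
  assumes r: "r \<in> codes n k" "first_nz n r = n + 2" and n: "1 \<le> n"
    and near: "rooted_tree.near (codes n k) (children n) d x y"
  shows "differ_by_transpositions n d (decode n x) (decode n y)"
proof -
  interpret rooted_tree "codes n k" "children n" "weight n" "n * k" r
    by (rule rooted_tree_codes[OF r n])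
  \<comment> \<open>A transposition is its own inverse, so one factor serves both directions of an
    edge.\<close>
  have edge: "\<exists>\<theta>. is_transposition n \<theta> \<and> decode n z = decode n y \<circ> \<theta> \<and> decode n y = decode n z \<circ> \<theta>"
    if "(z, y) \<in> E" for y z
  proof -
    have y: "y \<in> codes n k" "first_nz n y \<le> n" "up (first_nz n y) y = z"
      using that by (auto simp: E_def children_iff[OF _ n])
    note d = decode_parent[OF y(1) n y(2)]
    let ?\<theta> = "transpose (pos y) (first_nz n y)"
    have "pos y \<in> {1..n}" "first_nz n y \<in> {1..n}" "pos y \<noteq> first_nz n y"
      using d(1,2) y(2) by auto
    then have "is_transposition n ?\<theta>" unfolding is_transposition_def by blast
    moreover have z: "decode n z = decode n y \<circ> ?\<theta>" using d(3) y(3) by simp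
    moreover have "decode n y = decode n z \<circ> ?\<theta>"
      unfolding z comp_assoc transpose_comp_involutory by simp
    ultimately show ?thesis by blast
  qed
  have path: "\<exists>\<theta>s. length \<theta>s = i \<and> (\<forall>\<theta>\<in>set \<theta>s. is_transposition n \<theta>) \<and>
      decode n y = foldl (\<circ>) (decode n x) \<theta>s" if "(x, y) \<in> (E \<union> E\<inverse>) ^^ i" for i x y
    using that
  proof (induction i arbitrary: y)
    case 0
    then show ?case by simp
  next
    case (Suc i)
    then obtain z where z: "(x, z) \<in> (E \<union> E\<inverse>) ^^ i" "(z, y) \<in> E \<union> E\<inverse>" by auto
    from Suc.IH[OF z(1)] obtain \<theta>s where \<theta>s: "length \<theta>s = i" "\<forall>\<theta>\<in>set \<theta>s. is_transposition n \<theta>"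
      "decode n z = foldl (\<circ>) (decode n x) \<theta>s" by blast
    have "\<exists>\<theta>. is_transposition n \<theta> \<and> decode n y = decode n z \<circ> \<theta>"
      using z(2) edge[of z y] edge[of y z] by blast
    then obtain \<theta> where "is_transposition n \<theta>" "decode n y = decode n z \<circ> \<theta>" by blast
    then show ?case using \<theta>s
      by (intro exI[of _ "\<theta>s @ [\<theta>]"] conjI) (simp, simp, simp only: foldl_append foldl.simps)
  qed
  from near obtain i where "i \<le> d" "(x, y) \<in> (E \<union> E\<inverse>) ^^ i" unfolding near_def by blast
  with path[OF this(2)] show ?thesis unfolding differ_by_transpositions_def by blast
qed

lemma gray_code:
  assumes r: "r \<in> codes n k" "first_nz n r = n + 2" and n: "1 \<le> n"
  defines "\<pi>s \<equiv> map (decode n) (walk (children n) (Suc (n * k)) True r)"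
  shows "distinct \<pi>s" "set \<pi>s = perms_maj n k" "successively (differ_by_transpositions n 3) \<pi>s"
proof -
  interpret rooted_tree "codes n k" "children n" "weight n" "n * k" r
    by (rule rooted_tree_codes[OF r n])
  let ?w = "walk (children n) (Suc (n * k)) True r"
  have set: "set ?w = codes n k" by (rule set_walk_root) simp
  have dist: "distinct ?w" by (rule distinct_walk[OF r(1)]) simp
  show "set \<pi>s = perms_maj n k"
    unfolding \<pi>s_def set_map set by (rule bij_betw_imp_surj_on[OF decode_bij])
  show "distinct \<pi>s"
    unfolding \<pi>s_def distinct_map set using dist decode_bij by (auto simp: bij_betw_def)
  have "successively (near 3) ?w" using walk_near[OF r(1), of "Suc (n * k)"] by (simp only:)
  then show "successively (differ_by_transpositions n 3) \<pi>s"
    unfolding \<pi>s_def successively_map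
    by (rule successively_mono) (rule near_transpositions[OF r n])
qed

section \<open>Links between the nonzero entries\<close>

text \<open>Only the entries beyond the first \<open>full_upto x + 1\<close> places are linked: the links inside that
  prefix are stale, and a place is linked again when the prefix shrinks below it.\<close>

definition linked :: "nat \<Rightarrow> (nat \<Rightarrow> nat) \<Rightarrow> (nat \<Rightarrow> int) \<Rightarrow> bool" where
  "linked n x A \<longleftrightarrow> (\<forall>i. full_upto x + 2 \<le> i \<longrightarrow> i \<le> n \<longrightarrow> 0 < x i \<longrightarrow> A i = int (next_nz n x i))"

lemma linkedD: "linked n x A \<Longrightarrow> full_upto x + 2 \<le> i \<Longrightarrow> i \<le> n \<Longrightarrow> 0 < x i \<Longrightarrow> A i = int (next_nz n x i)"
  by (simp add: linked_def)

text \<open>No linked entry of the child precedes \<open>l\<close>, so only the link of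
  \<open>l\<close> may need setting. If \<open>h = l\<close>, the place was nonzero and linked
  before. For \<open>c = 0\<close> its link may be stale, and it is always overwritten because
  \<open>h\<close> lies beyond \<open>l\<close>.\<close>

lemma linked_dn:
  assumes x: "x \<in> codes n k" and n: "1 \<le> n" and c: "c < 3" and v: "valid n x (cand n x c)"
    and A: "linked n x A"
  defines "l \<equiv> cand n x c" and "h \<equiv> if c = 2 then next_nz n x (first_nz n x) else first_nz n x"
  shows "linked n (dn l x) (if h = l then A else A(l := int h))"
  unfolding linked_def
proof (intro allI impI)
  fix i assume i: "full_upto (dn l x) + 2 \<le> i" "i \<le> n" "0 < dn l x i"
  note s = dn_shape[OF x n c v, folded l_def]
  note g = first_nz[OF x n]
  have y: "dn l x \<in> codes n k" by (rule s(2))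
  have ln: "l \<le> n" using v by (simp add: valid_def l_def)
  have li: "l \<le> i" using first_nz(4)[OF y n i(1)] s(4) i(3) by (cases "i < l") simp_all
  have same: "next_nz n (dn l x) i = next_nz n x i"
    by (rule next_nz_cong) (use li in \<open>auto simp: dn_def\<close>)
  have lc: "(c = 0 \<and> l = full_upto x + 1) \<or> (c = 1 \<and> l = full_upto x + 2) \<or> (c = 2 \<and> l = first_nz n x + 1)"
    using c by (auto simp: l_def cand_def)
  show "(if h = l then A else A(l := int h)) i = int (next_nz n (dn l x) i)"
  proof (cases "i = l")
    case False
    then have "full_upto x + 2 \<le> i" "0 < x i" using li lc g(1) i(3) by (auto simp: dn_def)
    then show ?thesis using linkedD[OF A _ i(2)] same False by simp
  next
    case True
    show ?thesis
    proof (cases "c = 0")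
      case c0: True
      then have "l = full_upto x + 1" "h = first_nz n x" using lc by (auto simp: h_def)
      then show ?thesis using g(1) same True by (simp add: first_nz_def)
    next
      case False
      then have h: "h = next_nz n x (l - 1)" using lc by (auto simp: h_def first_nz_def)
      have l1: "l - 1 \<le> n" using ln by simp
      have l0: "0 < l" by (rule less_le_trans[OF _ s(1)]) simp
      show ?thesis
      proof (cases "h = l")
        case hl: True
        then have "0 < x l" using next_nz(3)[of "l - 1" n x] ln h by auto
        moreover have "full_upto x + 2 \<le> l" using lc g(1) False by auto
        ultimately show ?thesis using linkedD[OF A _ ln] same True hl by simp
      next
        case hl: False
        then have "next_nz n x (Suc (l - 1)) = h"
          using next_nz_Suc[OF l1, of x] l0 h by simp
        then show ?thesis using True hl same l0 by simp
      qed
    qed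
  qed
qed

text \<open>Only for \<open>kind n y = 2\<close> does the unit land among the linked places, at
  \<open>l - 1\<close>; otherwise it goes directly behind the prefix. An emptied place
  \<open>l\<close> leaves no dangling link, since no nonzero linked place precedes it.\<close>

lemma linked_up:
  assumes y: "y \<in> codes n k" and n: "1 \<le> n" and le: "first_nz n y \<le> n" and A: "linked n y A"
  defines "l \<equiv> first_nz n y"
  defines "h \<equiv> if 1 < y l then l else next_nz n y l"
  shows "linked n (up l y) (if kind n y = 2 then A(l - 1 := int h) else A)"
  unfolding linked_def
proof (intro allI impI)
  fix i assume i: "full_upto (up l y) + 2 \<le> i" "i \<le> n" "0 < up l y i"
  note u = up_shape[OF y n le, folded l_def, folded h_def]
  note g = first_nz[OF y n, folded l_def]
  have k: "kind n y = 0 \<and> l = full_upto y + 2 \<or> kind n y = 1 \<and> l = full_upto y + 2 \<or> kind n y = 2"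
    using g(1) by (auto simp: kind_def l_def)
  have same: "next_nz n (up l y) i = next_nz n y i" if "l \<le> i"
    by (rule next_nz_cong) (use that in \<open>auto simp: up_def\<close>)
  consider "l \<le> i" | "i = l - 1" | "i < l - 1" by linarith
  then show "(if kind n y = 2 then A(l - 1 := int h) else A) i = int (next_nz n (up l y) i)"
  proof cases
    case 1
    then have "0 < y i" using i(3) g(3) le u(1) by (cases "i = l") (auto simp: up_def l_def split: if_splits)
    moreover have "full_upto y + 2 \<le> i" using 1 g(1) by simp
    ultimately have "A i = int (next_nz n (up l y) i)" using linkedD[OF A _ i(2)] same[OF 1] by simp
    then show ?thesis using 1 u(1) by auto
  next
    case 2
    then have "kind n y = 2" using i(1) u(5) k by auto
    then show ?thesis using 2 u(7) by simp
  next
    case 3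
    then have "up l y i = y i" by (auto simp: up_def)
    moreover have "full_upto y + 2 \<le> i" using i(1) u(5) by (simp split: if_splits)
    ultimately show ?thesis using g(4)[of i] 3 i(3) by simp
  qed
qed

section \<open>The program\<close>

text \<open>A function for loop-free commands, so that the simplifier can execute them symbolically;
  loops are handled through \<open>exec\<close>.\<close>

fun run :: "int \<Rightarrow> com \<Rightarrow> state \<Rightarrow> (state \<times> (nat \<Rightarrow> int) list) option" where
  "run B Skip s = Some (s, [])"
| "run B (Assign x e) s = map_option (\<lambda>v. (set_reg x v s, [])) (eval B s e)"
| "run B (Store a e1 e2) s = Option.bind (eval B s e1) (\<lambda>i.
     if i < 0 then None else map_option (\<lambda>v. (set_cell a (nat i) v s, [])) (eval B s e2))"
| "run B (Seq c1 c2) s = Option.bind (run B c1 s) (\<lambda>(s', o1).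
     map_option (\<lambda>(t, o2). (t, o1 @ o2)) (run B c2 s'))"
| "run B (Cond e c1 c2) s = Option.bind (eval B s e) (\<lambda>v. run B (if v \<noteq> 0 then c1 else c2) s)"
| "run B (While e c) s = None"
| "run B Output s = Some (s, [arrs s 0])"

fun cost_bound :: "com \<Rightarrow> nat" where
  "cost_bound Skip = 1"
| "cost_bound (Assign x e) = 1 + ecost e"
| "cost_bound (Store a e1 e2) = 1 + ecost e1 + ecost e2"
| "cost_bound (Seq c1 c2) = cost_bound c1 + cost_bound c2"
| "cost_bound (Cond e c1 c2) = 1 + ecost e + cost_bound c1 + cost_bound c2"
| "cost_bound (While e c) = 0"
| "cost_bound Output = 1"

lemma run_exec: "run B c s = Some (t, out) \<Longrightarrow> \<exists>m \<le> cost_bound c. exec B c s t out m"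
proof (induction c arbitrary: s t out)
  case (Seq c1 c2)
  then obtain s' o1 o2 where "run B c1 s = Some (s', o1)" "run B c2 s' = Some (t, o2)" "out = o1 @ o2"
    by (auto simp: bind_eq_Some_conv)
  with Seq.IH obtain m1 m2 where "m1 \<le> cost_bound c1" "exec B c1 s s' o1 m1"
    "m2 \<le> cost_bound c2" "exec B c2 s' t o2 m2" by blast
  with exec.Seq[of B c1 s s' o1 m1 c2 t o2 m2] \<open>out = o1 @ o2\<close> show ?case
    by (intro exI[of _ "m1 + m2"]) simp
next
  case (Cond e c1 c2)
  then obtain v where v: "eval B s e = Some v" "run B (if v \<noteq> 0 then c1 else c2) s = Some (t, out)"
    by (auto simp: bind_eq_Some_conv)
  show ?case
  proof (cases "v = 0")
    case True
    with v Cond.IH(2)[of s t out] obtain m where "m \<le> cost_bound c2" "exec B c2 s t out m" by auto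
    with exec.CondFalse[of B s e c2 t out m c1] v True show ?thesis
      by (intro exI[of _ "1 + ecost e + m"]) simp
  next
    case False
    with v Cond.IH(1)[of s t out] obtain m where "m \<le> cost_bound c1" "exec B c1 s t out m" by auto
    with exec.CondTrue[of B s e v c1 t out m c2] v False show ?thesis
      by (intro exI[of _ "1 + ecost e + m"]) simp
  qed
next
  case (Assign x e)
  then obtain v where "eval B s e = Some v" "t = set_reg x v s" "out = []" by auto
  with exec.Assign[of B s e v x] show ?case by (intro exI[of _ "1 + ecost e"]) simp
next
  case (Store a e1 e2)
  then obtain i v where "eval B s e1 = Some i" "0 \<le> i" "eval B s e2 = Some v"
    "t = set_cell a (nat i) v s" "out = []"
    by (auto simp: bind_eq_Some_conv split: if_splits)
  with exec.Store[of B s e1 i e2 v a] show ?case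
    by (intro exI[of _ "1 + ecost e1 + ecost e2"]) simp
next
  case Skip
  with exec.Skip[of B s] show ?case by (intro exI[of _ 1]) simp
next
  case Output
  with exec.Output[of B s] show ?case by (intro exI[of _ 1]) auto
qed simp

lemma while_count:
  assumes step: "\<And>i s. I i s \<Longrightarrow> i < N \<Longrightarrow>
      \<exists>v s'. eval B s e = Some v \<and> v \<noteq> 0 \<and> run B c s = Some (s', []) \<and> I (Suc i) s'"
    and exit: "\<And>s. I N s \<Longrightarrow> eval B s e = Some 0"
    and start: "I i s" "i \<le> N"
  shows "\<exists>t m. exec B (While e c) s t [] m \<and> I N t \<and> m \<le> (N - i + 1) * (1 + ecost e + cost_bound c)"
  using start
proof (induction "N - i" arbitrary: i s)
  case 0
  then have "I N s" by simp
  moreover have "i = N" using 0 by simp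
  ultimately show ?case
    using exec.WhileFalse[OF exit, of s c] Suc_le_eq by (intro exI[of _ s] exI[of _ "1 + ecost e"]) simp
next
  case (Suc d)
  have i: "i < N" using Suc.hyps(2) by simp
  from step[OF Suc.prems(1) i] obtain v s' where
    s': "eval B s e = Some v" "v \<noteq> 0" "run B c s = Some (s', [])" "I (Suc i) s'" by blast
  from run_exec[OF s'(3)] obtain m1 where m1: "m1 \<le> cost_bound c" "exec B c s s' [] m1" by blast
  have "d = N - Suc i" "Suc i \<le> N" using Suc.hyps(2) by simp_all
  from Suc.hyps(1)[OF this(1) s'(4) this(2)] obtain t m2 where
    t: "exec B (While e c) s' t [] m2" "I N t" "m2 \<le> (N - Suc i + 1) * (1 + ecost e + cost_bound c)"
    by blast
  have "N - i = Suc (N - Suc i)" using i by simp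
  then have "1 + ecost e + m1 + m2 \<le> (N - i + 1) * (1 + ecost e + cost_bound c)"
    using m1(1) t(3) by simp
  moreover have "exec B (While e c) s t [] (1 + ecost e + m1 + m2)"
    using exec.WhileTrue[OF s'(1,2) m1(2) t(1)] by simp
  ultimately show ?case using t(2) by blast
qed

section \<open>The commands of the walk\<close>

text \<open>Registers: 0 \<open>n\<close>, 1 \<open>k\<close> and later the part of \<open>k\<close> not yet distributed, 2 the index of the next
  child to try, 3 the parity of the depth, 4 \<open>full_upto\<close>, 5 \<open>first_nz\<close>, 6 the loop flag, 7 the place
  \<open>l\<close> of the move, 8 and 9 scratch. Arrays: 0 the permutation, 1 its code, 2 the successor links
  between nonzero entries of the code.\<close>

definition swap_places :: com where
  "swap_places =
     Seq (Assign 8 (Bin Sub (Reg 4) (Read 1 (Bin Add (Reg 4) (Const 1)))))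
    (Seq (Assign 9 (Read 0 (Reg 8)))
    (Seq (Store 0 (Reg 8) (Read 0 (Reg 7)))
         (Store 0 (Reg 7) (Reg 9))))"

text \<open>The counter is advanced before the candidate is tested, so later commands see
  \<open>c + 1\<close> for candidate \<open>c\<close>.\<close>

definition pick :: com where
  "pick =
     Seq (Cond (Bin Less (Reg 2) (Const 2))
           (Assign 7 (Bin Add (Bin Add (Reg 4) (Reg 2)) (Const 1)))
           (Assign 7 (Bin Add (Reg 5) (Const 1))))
         (Assign 2 (Bin Add (Reg 2) (Const 1)))"

text \<open>Multiplication is conjunction. Register 2 divided by 3 is 1 for the third candidate and
  0 for the others, so the last factor asks for a single unit at \<open>l - 1\<close> only
  there.\<close>

definition test :: expr where
  "test = Bin Mul (Bin Mul (Bin Less (Const 0) (Read 1 (Bin Sub (Reg 7) (Const 1))))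
                           (Bin Less (Read 1 (Reg 7)) (Bin Sub (Reg 7) (Const 1))))
                  (Bin Less (Bin Mul (Read 1 (Bin Sub (Reg 7) (Const 1))) (Bin Div (Reg 2) (Const 3)))
                            (Const 2))"

definition relink :: com where
  "relink =
     Seq (Cond (Bin Equal (Reg 2) (Const 3)) (Assign 9 (Read 2 (Reg 5))) (Assign 9 (Reg 5)))
         (Cond (Bin Equal (Reg 9) (Reg 7)) Skip (Store 2 (Reg 7) (Reg 9)))"

definition move_right :: com where
  "move_right =
     Seq (Assign 4 (Bin Sub (Reg 4) (Bin Equal (Reg 2) (Const 1))))
    (Seq (Store 1 (Bin Sub (Reg 7) (Const 1)) (Bin Sub (Read 1 (Bin Sub (Reg 7) (Const 1))) (Const 1)))
    (Seq (Store 1 (Reg 7) (Bin Add (Read 1 (Reg 7)) (Const 1)))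
    (Seq (Assign 5 (Reg 7))
    (Seq (Assign 2 (Const 0))
         (Assign 3 (Bin Sub (Const 1) (Reg 3)))))))"

text \<open>\<open>relink\<close> needs the registers of the parent, whereas
  \<open>swap_places\<close> reads the place \<open>pos\<close> off the code of the child; hence it
  runs after the move here and before the move in \<open>ascend\<close>.\<close>

definition descend :: com where
  "descend = Seq pick (Cond (Bin Less (Reg 7) (Bin Add (Reg 0) (Const 1)))
     (Cond test (Seq relink (Seq move_right swap_places)) Skip) Skip)"

text \<open>The three branches are the values 0, 1, 2 of \<open>kind\<close>. Register 2 must end up
  one above that value, to continue with the next sibling; in the third branch it already is
  3.\<close>

definition move_left :: com where
  "move_left =
     Seq (Store 1 (Bin Sub (Reg 7) (Const 1)) (Bin Add (Read 1 (Bin Sub (Reg 7) (Const 1))) (Const 1)))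
    (Seq (Store 1 (Reg 7) (Bin Sub (Read 1 (Reg 7)) (Const 1)))
    (Seq (Cond (Bin Less (Const 0) (Read 1 (Reg 7))) (Assign 9 (Reg 7)) (Assign 9 (Read 2 (Reg 7))))
    (Seq (Cond (Bin Equal (Reg 7) (Bin Add (Reg 4) (Const 2)))
           (Cond (Bin Equal (Read 1 (Bin Add (Reg 4) (Const 1))) (Reg 4))
              (Seq (Assign 4 (Bin Add (Reg 4) (Const 1)))
              (Seq (Assign 5 (Read 2 (Reg 7)))
                   (Assign 2 (Const 1))))
              (Seq (Assign 5 (Reg 9))
                   (Assign 2 (Const 2))))
           (Seq (Store 2 (Bin Sub (Reg 7) (Const 1)) (Reg 9))
                (Assign 5 (Bin Sub (Reg 7) (Const 1)))))
         (Assign 3 (Bin Sub (Const 1) (Reg 3))))))"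

definition ascend :: com where
  "ascend = Cond (Bin Less (Reg 0) (Reg 5)) (Assign 6 (Const 0))
     (Seq (Assign 7 (Reg 5)) (Seq swap_places move_left))"

text \<open>Counter 0 is met only on entering a code and 3 only on leaving it; three times the
  parity selects the former at even and the latter at odd depth.\<close>

definition emit :: com where
  "emit = Cond (Bin Equal (Reg 2) (Bin Mul (Const 3) (Reg 3))) Output Skip"

definition body :: com where
  "body = Seq emit (Cond (Bin Less (Reg 2) (Const 3)) descend ascend)"

section \<open>Effect of one iteration on the represented code\<close>

definition rep :: "nat \<Rightarrow> (nat \<Rightarrow> nat) \<Rightarrow> nat \<Rightarrow> bool \<Rightarrow> state \<Rightarrow> bool" where
  "rep n x c b s \<longleftrightarrow> regs s 0 = int n \<and> regs s 2 = int c \<and> regs s 3 = (if b then 0 else 1) \<and>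
     regs s 4 = int (full_upto x) \<and> regs s 5 = int (first_nz n x) \<and> regs s 6 = 1 \<and>
     arrs s 1 = (\<lambda>i. int (x i)) \<and> stores_perm n (arrs s 0) (decode n x) \<and> linked n x (arrs s 2)"

lemma regs_set_reg [simp]: "regs (set_reg r v s) = (regs s)(r := v)"
  by (simp add: set_reg_def)

lemma arrs_set_reg [simp]: "arrs (set_reg r v s) = arrs s"
  by (simp add: set_reg_def)

lemma regs_set_cell [simp]: "regs (set_cell a i v s) = regs s"
  by (simp add: set_cell_def)

lemma arrs_set_cell [simp]: "arrs (set_cell a i v s) = (arrs s)(a := (arrs s a)(i := v))"
  by (simp add: set_cell_def)

lemma fits_Some: "\<bar>v\<bar> \<le> B \<Longrightarrow> fits B v = Some v"
  by (simp add: fits_def)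

lemma eval_Bin:
  "eval B s e1 = Some x \<Longrightarrow> eval B s e2 = Some y \<Longrightarrow> binop_val f x y = Some z \<Longrightarrow> \<bar>z\<bar> \<le> B \<Longrightarrow>
    eval B s (Bin f e1 e2) = Some z"
  by (simp add: fits_Some)

lemma nat_int_succ: "nat (int l + 1) = l + 1" by simp

lemma run_Seq:
  "run B c1 s = Some (s', o1) \<Longrightarrow> run B c2 s' = Some (t, o2) \<Longrightarrow> run B (Seq c1 c2) s = Some (t, o1 @ o2)"
  by simp

lemma run_Cond_True:
  "eval B s e = Some v \<Longrightarrow> v \<noteq> 0 \<Longrightarrow> run B c1 s = r \<Longrightarrow> run B (Cond e c1 c2) s = r"
  by simp

lemma run_Cond_False:
  "eval B s e = Some 0 \<Longrightarrow> run B c2 s = r \<Longrightarrow> run B (Cond e c1 c2) s = r"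
  by simp

lemma stores_perm_swap:
  assumes "stores_perm n A \<pi>" "p \<in> {1..n}" "l \<in> {1..n}"
  shows "stores_perm n (A(p := A l, l := A p)) (\<pi> \<circ> transpose p l)"
  using assms by (auto simp: stores_perm_def transpose_def)

text \<open>Values stay linear in \<open>n\<close>; the factor 3 leaves room for the offsets in the
  first permutation. The input \<open>k\<close>, which can be quadratic, is bounded separately in
  \<open>exec_init\<close>.\<close>

locale machine =
  fixes n k :: nat and B :: int
  assumes n: "1 \<le> n" and B: "3 * int n + 10 \<le> B"
begin

text \<open>\<open>\<pi>\<close> is not tied to \<open>y\<close>: on the way down the array still
  holds the permutation of the parent while the code is already that of the child.\<close>

lemma run_swap_places:
  assumes y: "y \<in> codes n k" and s: "regs s 4 = int (full_upto y)" "regs s 7 = int l"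
    "arrs s 1 = (\<lambda>i. int (y i))" "stores_perm n (arrs s 0) \<pi>" and \<pi>: "\<pi> permutes {1..n}"
    and l: "l \<in> {1..n}"
  shows "\<exists>t. run B swap_places s = Some (t, []) \<and> stores_perm n (arrs t 0) (\<pi> \<circ> transpose (pos y) l) \<and>
    arrs t 1 = arrs s 1 \<and> arrs t 2 = arrs s 2 \<and> (\<forall>r<8. regs t r = regs s r)"
proof -
  define f where "f = full_upto y"
  note full = full_upto[OF y n, folded f_def]
  have p: "pos y \<in> {1..n}" using full(2,4) by (auto simp: pos_def f_def)
  have pos: "int f - int (y (Suc f)) = int (pos y)" using full(2) by (simp add: pos_def f_def)
  have A: "arrs s 0 i = int (\<pi> i)" "int (\<pi> i) \<le> B" if "i \<in> {1..n}" for i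
    using s(4) that permutes_in_image[OF \<pi>, of i] B by (auto simp: stores_perm_def)
  have bounds: "int f + 1 \<le> B" "int (y (Suc f)) \<le> B" "int (pos y) \<le> B" "int l \<le> B" "1 \<le> B"
    using full(2,4) p l B by auto
  have "run B swap_places s = Some
     (set_cell 0 l (arrs s 0 (pos y)) (set_cell 0 (pos y) (arrs s 0 l)
       (set_reg 9 (arrs s 0 (pos y)) (set_reg 8 (int (pos y)) s))), [])"
    using bounds A[OF p] A[OF l] s(1-3)
    by (simp add: swap_places_def fits_Some nat_int_succ pos f_def[symmetric])
  then show ?thesis
    using stores_perm_swap[OF s(4) p l] by simp
qed

lemma run_pick:
  assumes x: "x \<in> codes n k" and s: "rep n x c b s" and c: "c < 3"
  shows "\<exists>t. run B pick s = Some (t, []) \<and> rep n x (c + 1) b t \<and> regs t 7 = int (cand n x c)"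
proof -
  note full = full_upto[OF x n] and g = first_nz[OF x n]
  have bounds: "int (full_upto x) \<le> int n" "int (first_nz n x) \<le> int n + 2"
    using full(4) g(2) by auto
  have "c = 0 \<or> c = 1 \<or> c = 2" using c by auto
  then show ?thesis
    using s bounds B by (elim disjE) (simp_all add: pick_def rep_def fits_Some cand_def)
qed

lemma eval_test:
  assumes x: "x \<in> codes n k" and s: "rep n x (c + 1) b s" "regs s 7 = int (cand n x c)"
    and c: "c < 3" and le: "cand n x c \<le> n"
  shows "\<exists>v. eval B s test = Some v \<and> (v \<noteq> 0 \<longleftrightarrow> valid n x (cand n x c))"
proof -
  define l where "l = cand n x c"
  note full = full_upto[OF x n] and g = first_nz[OF x n]
  define m where "m = l - 1"
  have lm: "l = Suc m" using c full(3) g(1) by (auto simp: m_def l_def cand_def)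
  have "int (x i) \<le> B" if "i \<le> n" for i
    using codesD(1)[OF x, of i] that B by simp
  then have bounds: "int (x (Suc m)) \<le> B" "int (x m) \<le> B" "int m + 1 \<le> B" "3 \<le> B"
    using le B lm by (auto simp: l_def[symmetric])
  have lc: "(c = 0 \<and> l = full_upto x + 1) \<or> (c = 1 \<and> l = full_upto x + 2) \<or> (c = 2 \<and> l = first_nz n x + 1)"
    using c by (auto simp: l_def cand_def)
  \<comment> \<open>The candidates are pairwise distinct, so the last conjunct of
    \<open>valid\<close> concerns exactly \<open>c = 2\<close>.\<close>
  then have only: "l = first_nz n x + 1 \<longleftrightarrow> c = 2" using g(1) by auto
  have r: "regs s 2 = int c + 1" "regs s 7 = int m + 1" "arrs s 1 = (\<lambda>i. int (x i))"
    using s lm by (simp_all add: rep_def l_def[symmetric])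
  have pred: "eval B s (Bin Sub (Reg 7) (Const 1)) = Some (int m)"
    using r bounds by (simp add: fits_Some)
  then have prev: "eval B s (Read 1 (Bin Sub (Reg 7) (Const 1))) = Some (int (x m))"
    unfolding eval.simps(3) using r bounds by (simp add: fits_Some)
  have here: "eval B s (Read 1 (Reg 7)) = Some (int (x (Suc m)))"
    using r bounds by (simp add: fits_Some nat_int_succ)
  have third: "eval B s (Bin Div (Reg 2) (Const 3)) = Some (if c = 2 then 1 else 0)"
  proof -
    have "c = 0 \<or> c = 1 \<or> c = 2" using c by auto
    then show ?thesis using r(1) bounds(4) by (elim disjE) (simp_all add: fits_Some)
  qed
  have const: "eval B s (Const 0) = Some 0" "eval B s (Const 2) = Some 2"
    using bounds(4) by (simp_all add: fits_Some)
  have 1: "eval B s (Bin Less (Const 0) (Read 1 (Bin Sub (Reg 7) (Const 1)))) = Some (if 0 < x m then 1 else 0)"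
    by (rule eval_Bin[OF const(1) prev]) (use bounds in auto)
  have 2: "eval B s (Bin Less (Read 1 (Reg 7)) (Bin Sub (Reg 7) (Const 1))) =
      Some (if x (Suc m) < m then 1 else 0)"
    by (rule eval_Bin[OF here pred]) (use bounds in auto)
  have 3: "eval B s (Bin Mul (Read 1 (Bin Sub (Reg 7) (Const 1))) (Bin Div (Reg 2) (Const 3))) =
      Some (if c = 2 then int (x m) else 0)"
    by (rule eval_Bin[OF prev third]) (use bounds in auto)
  have "eval B s test = Some (if 0 < x m \<and> x l < m \<and> (c = 2 \<longrightarrow> x m < 2) then 1 else 0)"
    unfolding test_def lm
    by (rule eval_Bin[OF eval_Bin[OF 1 2] eval_Bin[OF 3 const(2)]], (rule binop_val.simps)+)
      (use bounds in auto)
  then show ?thesis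
    unfolding l_def[symmetric] valid_def using le only lm by (auto simp: l_def[symmetric])
qed

lemma run_relink:
  assumes x: "x \<in> codes n k" and s: "rep n x (c + 1) b s" "regs s 7 = int (cand n x c)"
    and c: "c < 3" and v: "valid n x (cand n x c)"
  shows "\<exists>t. run B relink s = Some (t, []) \<and> (\<forall>r<8. regs t r = regs s r) \<and>
    arrs t 0 = arrs s 0 \<and> arrs t 1 = arrs s 1 \<and> linked n (dn (cand n x c) x) (arrs t 2)"
proof -
  define l where "l = cand n x c"
  define h where "h = (if c = 2 then next_nz n x (first_nz n x) else first_nz n x)"
  note g = first_nz[OF x n]
  have ln: "l \<le> n" using v by (simp add: valid_def l_def)
  have link: "linked n x (arrs s 2)" using s(1) by (simp add: rep_def)
  note r = s(1)[unfolded rep_def] s(2)[folded l_def]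
  have g2: "int (first_nz n x) \<le> int n + 2" using g(2) by auto
  then have bounds: "int (first_nz n x) \<le> B" "int l \<le> B" "3 \<le> B" using ln B by auto
  let ?h = "Cond (Bin Equal (Reg 2) (Const 3)) (Assign 9 (Read 2 (Reg 5))) (Assign 9 (Reg 5))"
  have h: "int h \<le> B \<and> run B ?h s = Some (set_reg 9 (int h) s, [])"
  proof (cases "c = 2")
    case True
    then have gn: "first_nz n x \<le> n" using ln by (simp add: l_def cand_def)
    then have "arrs s 2 (first_nz n x) = int (next_nz n x (first_nz n x))"
      using linkedD[OF link g(1) gn g(3)[OF gn]] by simp
    moreover have "next_nz n x (first_nz n x) \<le> n + 2" using gn by (intro next_nz(2)) simp
    then have "int (next_nz n x (first_nz n x)) \<le> B" using B by simp
    ultimately show ?thesis using True r bounds by (simp add: h_def fits_Some)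
  next
    case False
    then have "c = 0 \<or> c = 1" using c by auto
    then show ?thesis using r bounds by (elim disjE) (simp_all add: h_def fits_Some)
  qed
  let ?t = "if h = l then set_reg 9 (int h) s else set_cell 2 l (int h) (set_reg 9 (int h) s)"
  have "run B relink s = Some (?t, [])"
    using h r bounds unfolding relink_def by (auto simp: fits_Some)
  moreover have "linked n (dn l x) (arrs ?t 2)"
    using linked_dn[OF x n c v link, folded l_def h_def] by (auto simp: if_distrib)
  ultimately show ?thesis by (auto simp: l_def[symmetric])
qed

lemma run_move_right:
  assumes x: "x \<in> codes n k" and c: "c < 3"
    and s: "regs s 2 = int c + 1" "regs s 3 = (if b then 0 else 1)" "regs s 4 = int (full_upto x)"
      "regs s 7 = int l" "arrs s 1 = (\<lambda>i. int (x i))"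
    and l: "2 \<le> l" "l \<le> n" "0 < x (l - 1)"
  shows "\<exists>t. run B move_right s = Some (t, []) \<and> regs t 0 = regs s 0 \<and> regs t 2 = 0 \<and>
    regs t 3 = (if \<not> b then 0 else 1) \<and>
    regs t 4 = int (if c = 0 then full_upto x - 1 else full_upto x) \<and> regs t 5 = int l \<and>
    regs t 6 = regs s 6 \<and> regs t 7 = int l \<and>
    arrs t 0 = arrs s 0 \<and> arrs t 1 = (\<lambda>i. int (dn l x i)) \<and> arrs t 2 = arrs s 2"
proof -
  note full = full_upto[OF x n]
  obtain m where lm: "l = Suc m" using l(1) by (cases l) simp_all
  have "int (x i) + 1 \<le> B" if "i \<le> n" for i
    using codesD(1)[OF x, of i] that B by simp
  from this[of l] this[of m] have bounds: "int (x (Suc m)) + 1 \<le> B" "int (x m) \<le> B"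
    "int m + 1 \<le> B" "3 \<le> B" "int (full_upto x) \<le> B"
    using l lm B full(4) by auto
  have s7: "regs s 7 = int m + 1" using s(4) lm by simp
  have xm: "1 \<le> int (x m)" using l(3) lm by simp
  have f1: "1 \<le> int (full_upto x)" using full(3) by simp
  let ?f = "if c = 0 then int (full_upto x) - 1 else int (full_upto x)"
  let ?t = "set_reg 3 (1 - regs s 3) (set_reg 2 0 (set_reg 5 (int m + 1)
    (set_cell 1 (Suc m) (int (x (Suc m)) + 1) (set_cell 1 m (int (x m) - 1) (set_reg 4 ?f s)))))"
  have c3: "c = 0 \<or> c = 1 \<or> c = 2" using c by auto
  have "run B move_right s = Some (?t, [])"
    using c3 s(1,2,3,5) s7 bounds xm f1
    by (elim disjE; cases b) (simp_all add: move_right_def fits_Some nat_int_succ)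
  moreover have "arrs ?t 1 = (\<lambda>i. int (dn l x i))"
    using s(5) lm xm by (auto simp: fun_eq_iff dn_def)
  moreover have "?f = int (if c = 0 then full_upto x - 1 else full_upto x)"
    using full(3) by simp
  ultimately show ?thesis using s(2,4) s7 by simp
qed

lemma run_descend:
  assumes x: "x \<in> codes n k" and s: "rep n x c b s" and c: "c < 3"
  defines "l \<equiv> cand n x c"
  shows "\<exists>t. run B descend s = Some (t, []) \<and>
    (if valid n x l then rep n (dn l x) 0 (\<not> b) t else rep n x (c + 1) b t)"
proof -
  from run_pick[OF x s c] obtain s1 where
    s1: "run B pick s = Some (s1, [])" "rep n x (c + 1) b s1" "regs s1 7 = int l"
    by (auto simp: l_def)
  note r1 = s1(2)[unfolded rep_def] s1(3)
  have "l \<le> n + 3" using first_nz(2)[OF x n] full_upto(4)[OF x n] c by (auto simp: l_def cand_def)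
  then have bounds: "int l \<le> B" "int n + 1 \<le> B" "1 \<le> B" using B by auto
  have cmp: "eval B s1 (Bin Less (Reg 7) (Bin Add (Reg 0) (Const 1))) = Some (if l \<le> n then 1 else 0)"
    using r1 bounds by (simp add: fits_Some)
  show ?thesis
  proof (cases "l \<le> n")
    case False
    have "run B descend s = Some (s1, [] @ [])"
      unfolding descend_def
      by (rule run_Seq[OF s1(1)], rule run_Cond_False[OF cmp[unfolded if_not_P[OF False]]]) simp
    then show ?thesis using False s1(2) by (auto simp: valid_def)
  next
    case True
    from eval_test[OF x s1(2) _ c] s1(3) True obtain v where
      v: "eval B s1 test = Some v" "v \<noteq> 0 \<longleftrightarrow> valid n x l" by (auto simp: l_def)
    show ?thesis
    proof (cases "valid n x l")
      case False
      then have "eval B s1 test = Some 0" using v by simp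
      then have "run B descend s = Some (s1, [] @ [])"
        unfolding descend_def using cmp True
        by (intro run_Seq[OF s1(1)] run_Cond_True[OF cmp] run_Cond_False) simp_all
      then show ?thesis using False s1(2) by auto
    next
      case val: True
      define y where "y = dn l x"
      note sh = dn_shape[OF x n c, folded l_def, OF val, folded y_def]
      have pos: "0 < x (l - 1)" using val by (simp add: valid_def)
      from run_relink[OF x s1(2) s1(3)[unfolded l_def] c val[unfolded l_def], folded l_def, folded y_def]
      obtain s2 where s2: "run B relink s1 = Some (s2, [])" "\<And>r. r < 8 \<Longrightarrow> regs s2 r = regs s1 r"
        "arrs s2 0 = arrs s1 0" "arrs s2 1 = arrs s1 1" "linked n y (arrs s2 2)" by blast
      from run_move_right[OF x c _ _ _ _ _ sh(1) True pos, of s2 b] s2(2,4) r1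
      obtain s3 where s3: "run B move_right s2 = Some (s3, [])" "regs s3 0 = int n" "regs s3 2 = 0"
        "regs s3 3 = (if \<not> b then 0 else 1)"
        "regs s3 4 = int (full_upto y)" "regs s3 5 = int l" "regs s3 6 = 1" "regs s3 7 = int l"
        "arrs s3 0 = arrs s2 0" "arrs s3 1 = (\<lambda>i. int (y i))" "arrs s3 2 = arrs s2 2"
        by (auto simp: y_def[symmetric] sh(3))
      have "l \<in> {1..n}" using sh(1) True by simp
      from run_swap_places[OF sh(2) s3(5,8,10) _ decode_permutes this, of x] r1 s3(9) s2(3)
      obtain s4 where s4: "run B swap_places s3 = Some (s4, [])"
        "stores_perm n (arrs s4 0) (decode n x \<circ> transpose (pos y) l)"
        "arrs s4 1 = arrs s3 1" "arrs s4 2 = arrs s3 2" "\<And>r. r < 8 \<Longrightarrow> regs s4 r = regs s3 r"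
        by auto
      have "up l y = x" unfolding y_def by (rule up_dn[where x = x, OF sh(1) pos])
      then have "decode n x = decode n y \<circ> transpose (pos y) l"
        using decode_parent(3)[OF sh(2) n] sh(4) True by simp
      then have perm: "decode n x \<circ> transpose (pos y) l = decode n y"
        by (simp add: comp_assoc transpose_comp_involutory)
      have "rep n y 0 (\<not> b) s4"
        unfolding rep_def using s4 s3 s2(5) perm sh(4) by simp
      moreover have "v \<noteq> 0" using v(2) val by simp
      have "run B descend s = Some (s4, [] @ ([] @ ([] @ [])))"
        unfolding descend_def
        by (rule run_Seq[OF s1(1)], rule run_Cond_True[OF cmp], use True in simp,
            rule run_Cond_True[OF v(1) \<open>v \<noteq> 0\<close>],
            rule run_Seq[OF s2(1)], rule run_Seq[OF s3(1) s4(1)])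
      ultimately show ?thesis using val by (simp add: y_def)
    qed
  qed
qed

end

section \<open>Chaining iterations of the main loop\<close>

definition main_loop :: com where
  "main_loop = While (Reg 6) body"

text \<open>A big-step relation cannot express a run that stops inside the loop, so such a run is
  given by its effect: it extends every complete run from \<open>s'\<close> to one from
  \<open>s\<close>.\<close>

definition reach :: "int \<Rightarrow> state \<Rightarrow> state \<Rightarrow> (nat \<Rightarrow> int) list \<Rightarrow> nat \<Rightarrow> bool" where
  "reach B s s' outs M \<longleftrightarrow> (\<exists>m\<le>M. \<forall>t outs' m'. exec B main_loop s' t outs' m' \<longrightarrow>
     exec B main_loop s t (outs @ outs') (m + m'))"

definition step_cost :: nat where
  "step_cost = 2 + cost_bound body"

lemma reach_trans:
  assumes "reach B s s1 o1 M1" "reach B s1 s2 o2 M2"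
  shows "reach B s s2 (o1 @ o2) (M1 + M2)"
proof -
  from assms obtain m1 m2 where m1: "m1 \<le> M1"
      "\<And>t outs' m'. exec B main_loop s1 t outs' m' \<Longrightarrow> exec B main_loop s t (o1 @ outs') (m1 + m')"
    and m2: "m2 \<le> M2"
      "\<And>t outs' m'. exec B main_loop s2 t outs' m' \<Longrightarrow> exec B main_loop s1 t (o2 @ outs') (m2 + m')"
    unfolding reach_def by blast
  have "exec B main_loop s t ((o1 @ o2) @ outs') ((m1 + m2) + m')" if "exec B main_loop s2 t outs' m'" for t outs' m'
    using m1(2)[OF m2(2)[OF that]] by (simp add: add.assoc)
  then show ?thesis unfolding reach_def using m1(1) m2(1) by (intro exI[of _ "m1 + m2"]) simp
qed

lemma reach_step:
  assumes "regs s 6 = 1" "1 \<le> B" "run B body s = Some (s', outs)"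
  shows "reach B s s' outs step_cost"
proof -
  obtain m where m: "m \<le> cost_bound body" "exec B body s s' outs m"
    using run_exec[OF assms(3)] by blast
  have e: "eval B s (Reg 6) = Some 1" using assms(1,2) by (simp add: fits_Some)
  have "exec B main_loop s t (outs @ outs') ((2 + m) + m')" if "exec B main_loop s' t outs' m'" for t outs' m'
    using exec.WhileTrue[OF e one_neq_zero m(2) that[unfolded main_loop_def]]
    by (simp add: main_loop_def)
  then show ?thesis unfolding reach_def step_cost_def using m(1) by (intro exI[of _ "2 + m"]) simp
qed

context machine
begin

lemma run_move_left:
  assumes y: "y \<in> codes n k" and le: "first_nz n y \<le> n"
    and s: "regs s 2 = 3" "regs s 3 = (if b then 0 else 1)" "regs s 4 = int (full_upto y)"
      "regs s 7 = int (first_nz n y)" "arrs s 1 = (\<lambda>i. int (y i))" "linked n y (arrs s 2)"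
  defines "x \<equiv> up (first_nz n y) y"
  shows "\<exists>t. run B move_left s = Some (t, []) \<and> regs t 0 = regs s 0 \<and> regs t 2 = int (kind n y + 1) \<and>
    regs t 3 = (if \<not> b then 0 else 1) \<and> regs t 4 = int (full_upto x) \<and> regs t 5 = int (first_nz n x) \<and>
    regs t 6 = regs s 6 \<and> arrs t 0 = arrs s 0 \<and> arrs t 1 = (\<lambda>i. int (x i)) \<and> linked n x (arrs t 2)"
proof -
  define l where "l = first_nz n y"
  define f where "f = full_upto y"
  define h where "h = (if 1 < y l then l else next_nz n y l)"
  define m where "m = l - 1"
  note full = full_upto[OF y n, folded f_def] and g = first_nz[OF y n, folded l_def f_def]
  note u = up_shape[OF y n le, folded x_def l_def f_def, folded h_def]
  have lm: "l = Suc m" using u(1) by (simp add: m_def)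
  have ln: "l \<le> n" and yl: "1 \<le> y l" using le g(3) by (simp_all add: l_def)
  have nz: "next_nz n y l \<le> n + 2" using ln by (intro next_nz(2)) simp
  have link: "arrs s 2 l = int (next_nz n y l)"
    using linkedD[OF s(6) _ ln] g(1) yl by (simp add: f_def[symmetric])
  have x_l: "x l = y l - 1" and x_m: "x m = y m + 1" using lm by (auto simp: x_def l_def[symmetric] up_def)
  have xf: "x (Suc f) \<le> f" using codesD(1)[OF u(2), of "Suc f"] by simp
  have "int (y i) + 1 \<le> B" if "i \<le> n" for i
    using codesD(1)[OF y, of i] that B by simp
  from this[of l] this[of m] have bounds: "int (y l) \<le> B" "int (y m) + 1 \<le> B" "int (x (Suc f)) \<le> B"
    "int m + 1 \<le> B" "3 \<le> B" "int f + 2 \<le> B" "int h \<le> B" "int (next_nz n y l) \<le> B"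
    using ln lm B full(4) xf nz by (auto simp: h_def)
  have s7: "regs s 7 = int m + 1" using s(4) lm by (simp add: l_def[symmetric])
  have s4: "regs s 4 = int f" using s(3) by (simp add: f_def)
  define s1 where "s1 = set_cell 1 m (int (y m) + 1) s"
  define s2 where "s2 = set_cell 1 l (int (y l) - 1) s1"
  define s3 where "s3 = set_reg 9 (int h) s2"
  have 1: "run B (Store 1 (Bin Sub (Reg 7) (Const 1)) (Bin Add (Read 1 (Bin Sub (Reg 7) (Const 1))) (Const 1))) s
      = Some (s1, [])"
    using s7 s(5) bounds by (simp add: fits_Some s1_def)
  have 2: "run B (Store 1 (Reg 7) (Bin Sub (Read 1 (Reg 7)) (Const 1))) s1 = Some (s2, [])"
    using s7 s(5) bounds yl lm by (simp add: fits_Some s1_def s2_def nat_int_succ)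
  have a2: "arrs s2 1 = (\<lambda>i. int (x i))"
    using s(5) x_l x_m lm yl by (auto simp: s2_def s1_def x_def up_def l_def[symmetric] fun_eq_iff)
  have r2: "regs s2 = regs s" "arrs s2 2 = arrs s 2" "arrs s2 0 = arrs s 0"
    by (simp_all add: s2_def s1_def)
  have 3: "run B (Cond (Bin Less (Const 0) (Read 1 (Reg 7))) (Assign 9 (Reg 7)) (Assign 9 (Read 2 (Reg 7)))) s2
      = Some (s3, [])"
  proof -
    have e: "eval B s2 (Bin Less (Const 0) (Read 1 (Reg 7))) = Some (if 1 < y l then 1 else 0)"
      using s7 r2 a2 x_l bounds yl lm by (simp add: fits_Some nat_int_succ)
    show ?thesis
    proof (cases "1 < y l")
      case True
      then have "int h = int m + 1" using lm by (simp add: h_def)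
      then show ?thesis using e True s7 r2 bounds by (simp add: fits_Some s3_def del: eval.simps(4))
    next
      case False
      then have h: "int h = int (next_nz n y l)" by (simp add: h_def)
      have "eval B s2 (Read 2 (Reg 7)) = Some (int h)"
        using s7 r2 bounds link lm h by (simp add: fits_Some nat_int_succ)
      then show ?thesis using e False by (simp add: s3_def del: eval.simps)
    qed
  qed
  define R where "R = Cond (Bin Equal (Reg 7) (Bin Add (Reg 4) (Const 2)))
           (Cond (Bin Equal (Read 1 (Bin Add (Reg 4) (Const 1))) (Reg 4))
              (Seq (Assign 4 (Bin Add (Reg 4) (Const 1)))
              (Seq (Assign 5 (Read 2 (Reg 7)))
                   (Assign 2 (Const 1))))
              (Seq (Assign 5 (Reg 9))
                   (Assign 2 (Const 2))))
           (Seq (Store 2 (Bin Sub (Reg 7) (Const 1)) (Reg 9))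
                (Assign 5 (Bin Sub (Reg 7) (Const 1))))"
  have r3: "regs s3 7 = int m + 1" "regs s3 4 = int f" "regs s3 9 = int h" "regs s3 2 = 3"
    "arrs s3 1 = (\<lambda>i. int (x i))" "arrs s3 2 = arrs s 2"
    using r2 a2 s7 s4 s(1) by (simp_all add: s3_def)
  have e1: "eval B s3 (Bin Equal (Reg 7) (Bin Add (Reg 4) (Const 2))) = Some (if l = f + 2 then 1 else 0)"
    using r3 bounds lm by (auto simp: fits_Some)
  have e2: "eval B s3 (Bin Equal (Read 1 (Bin Add (Reg 4) (Const 1))) (Reg 4)) =
      Some (if x (Suc f) = f then 1 else 0)"
    using r3 bounds by (simp add: fits_Some nat_int_succ)
  have e3: "eval B s3 (Bin Sub (Reg 7) (Const 1)) = Some (int m)"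
    using r3 bounds by (simp add: fits_Some)
  have linked: "linked n x (if kind n y = 2 then (arrs s 2)(m := int h) else arrs s 2)"
    using linked_up[OF y n le s(6), folded x_def l_def, folded h_def m_def] .
  have "\<exists>s4. run B R s3 = Some (s4, []) \<and> regs s4 0 = regs s 0 \<and> regs s4 2 = int (kind n y + 1) \<and>
      regs s4 3 = regs s 3 \<and> regs s4 4 = int (full_upto x) \<and> regs s4 5 = int (first_nz n x) \<and>
      regs s4 6 = regs s 6 \<and> arrs s4 0 = arrs s 0 \<and> arrs s4 1 = (\<lambda>i. int (x i)) \<and> linked n x (arrs s4 2)"
  proof -
    \<comment> \<open>The program tests \<open>x (Suc f) = f\<close> after the move; for
      \<open>l = f + 2\<close> this is the condition on \<open>y (Suc f) + 1\<close> in
      \<open>kind\<close>.\<close>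
    consider (0) "kind n y = 0" "l = f + 2" "x (Suc f) = f" | (1) "kind n y = 1" "l = f + 2" "x (Suc f) \<noteq> f"
      | (2) "kind n y = 2" "l \<noteq> f + 2"
    proof -
      have "x (Suc f) = y (Suc f) + 1" if "l = f + 2" using x_m that by (simp add: m_def)
      then show ?thesis
        using that by (cases "l = f + 2"; cases "y (Suc f) + 1 = f") (auto simp: kind_def l_def f_def)
    qed
    then show ?thesis
    proof cases
      case 0
      let ?t = "set_reg 2 1 (set_reg 5 (int (next_nz n y l)) (set_reg 4 (int f + 1) s3))"
      have "run B R s3 = Some (?t, [])"
        unfolding R_def
        by (rule run_Cond_True[OF e1], use 0 in simp, rule run_Cond_True[OF e2], use 0 in simp)
          (use r3 bounds link lm in \<open>simp add: fits_Some nat_int_succ\<close>)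
      then show ?thesis using 0 u(5,6) linked r3(5) r2 s4 s7 by (simp add: s3_def r2 a2)
    next
      case 1
      let ?t = "set_reg 2 2 (set_reg 5 (int h) s3)"
      have "eval B s3 (Bin Equal (Read 1 (Bin Add (Reg 4) (Const 1))) (Reg 4)) = Some 0"
        using e2 1(3) by simp
      then have "run B R s3 = Some (?t, [])"
        unfolding R_def
        by (intro run_Cond_True[OF e1] run_Cond_False) (use 1 r3 bounds in \<open>simp_all add: fits_Some\<close>)
      then show ?thesis using 1 u(5,6) linked r3(5) r2 s4 s7 by (simp add: s3_def r2 a2)
    next
      case 2
      let ?t = "set_reg 5 (int m) (set_cell 2 m (int h) s3)"
      have "eval B s3 (Bin Equal (Reg 7) (Bin Add (Reg 4) (Const 2))) = Some 0"
        using e1 2(2) by simp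
      then have "run B R s3 = Some (?t, [])"
        unfolding R_def
        by (intro run_Cond_False) (use r3 bounds e3 in \<open>simp_all add: fits_Some\<close>)
      then show ?thesis using 2 u(5,6) linked r3(4,5,6) r2 s4 s7 lm by (simp add: s3_def r2 a2)
    qed
  qed
  then obtain s4 where s4: "run B R s3 = Some (s4, [])" "regs s4 0 = regs s 0" "regs s4 2 = int (kind n y + 1)"
      "regs s4 3 = regs s 3" "regs s4 4 = int (full_upto x)" "regs s4 5 = int (first_nz n x)"
      "regs s4 6 = regs s 6" "arrs s4 0 = arrs s 0" "arrs s4 1 = (\<lambda>i. int (x i))" "linked n x (arrs s4 2)"
    by blast
  have 5: "run B (Assign 3 (Bin Sub (Const 1) (Reg 3))) s4 = Some (set_reg 3 (1 - regs s 3) s4, [])"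
    using s4(4) s(2) bounds by (simp add: fits_Some)
  have "run B move_left s = Some (set_reg 3 (1 - regs s 3) s4, [] @ [] @ [] @ [] @ [])"
    unfolding move_left_def R_def[symmetric]
    by (rule run_Seq[OF 1 run_Seq[OF 2 run_Seq[OF 3 run_Seq[OF s4(1) 5]]]])
  then show ?thesis using s4 s(2) by simp
qed

lemma run_ascend:
  assumes y: "y \<in> codes n k" and s: "rep n y 3 b s" and le: "first_nz n y \<le> n"
  shows "\<exists>t. run B ascend s = Some (t, []) \<and> rep n (up (first_nz n y) y) (kind n y + 1) (\<not> b) t"
proof -
  define l where "l = first_nz n y"
  define s1 where "s1 = set_reg 7 (int l) s"
  note r = s[unfolded rep_def, folded l_def]
  have bounds: "int n \<le> B" "int l \<le> B" using le B by (auto simp: l_def)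
  have e: "eval B s (Bin Less (Reg 0) (Reg 5)) = Some 0"
    using r bounds le by (simp add: fits_Some l_def)
  have 1: "run B (Assign 7 (Reg 5)) s = Some (s1, [])"
    using r bounds by (simp add: fits_Some s1_def)
  have ln: "l \<in> {1..n}" using le first_nz(1)[OF y n] by (simp add: l_def)
  from run_swap_places[OF y _ _ _ _ decode_permutes ln, of s1 y] r
  obtain s2 where s2: "run B swap_places s1 = Some (s2, [])"
    "stores_perm n (arrs s2 0) (decode n y \<circ> transpose (pos y) l)"
    "arrs s2 1 = arrs s1 1" "arrs s2 2 = arrs s1 2" "\<And>i. i < 8 \<Longrightarrow> regs s2 i = regs s1 i"
    by (auto simp: s1_def)
  from run_move_left[OF y le, of s2 b, folded l_def] s2(3-5) r
  obtain s3 where s3: "run B move_left s2 = Some (s3, [])" "regs s3 0 = int n"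
    "regs s3 2 = int (kind n y + 1)" "regs s3 3 = (if \<not> b then 0 else 1)"
    "regs s3 4 = int (full_upto (up l y))" "regs s3 5 = int (first_nz n (up l y))" "regs s3 6 = 1"
    "arrs s3 0 = arrs s2 0" "arrs s3 1 = (\<lambda>i. int (up l y i))" "linked n (up l y) (arrs s3 2)"
    by (auto simp: s1_def)
  have "run B ascend s = Some (s3, [] @ [] @ [])"
    unfolding ascend_def by (rule run_Cond_False[OF e run_Seq[OF 1 run_Seq[OF s2(1) s3(1)]]])
  moreover have "rep n (up l y) (kind n y + 1) (\<not> b) s3"
    unfolding rep_def using s3 s2(2) decode_parent(3)[OF y n le, folded l_def] by simp
  ultimately show ?thesis by (simp add: l_def)
qed

lemma run_ascend_root:
  assumes y: "y \<in> codes n k" and s: "rep n y 3 b s" and root: "first_nz n y = n + 2"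
  shows "run B ascend s = Some (set_reg 6 0 s, [])"
  using s root B by (simp add: ascend_def rep_def fits_Some)

lemma run_emit:
  assumes "rep n x c b s" "c \<le> 3"
  shows "run B emit s = Some (s, if c = (if b then 0 else 3) then [arrs s 0] else [])"
  using assms B by (cases b) (simp_all add: emit_def rep_def fits_Some)

lemma eval_dispatch:
  assumes "rep n x c b s" "c \<le> 3"
  shows "eval B s (Bin Less (Reg 2) (Const 3)) = Some (if c < 3 then 1 else 0)"
  using assms B by (simp add: rep_def fits_Some)

lemma reach_descend:
  assumes x: "x \<in> codes n k" and s: "rep n x c b s" and c: "c < 3"
  shows "\<exists>t. reach B s t (if b \<and> c = 0 then [arrs s 0] else []) step_cost \<and>
    (if valid n x (cand n x c) then rep n (dn (cand n x c) x) 0 (\<not> b) t else rep n x (c + 1) b t)"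
proof -
  from run_descend[OF x s c] obtain t where t: "run B descend s = Some (t, [])"
    "if valid n x (cand n x c) then rep n (dn (cand n x c) x) 0 (\<not> b) t else rep n x (c + 1) b t"
    by blast
  have c3: "c \<le> 3" using c by simp
  have "run B body s = Some (t, (if c = (if b then 0 else 3) then [arrs s 0] else []) @ [])"
    unfolding body_def
    by (rule run_Seq[OF run_emit[OF s c3]], rule run_Cond_True[OF eval_dispatch[OF s c3]])
      (use c t in simp_all)
  moreover have "(if c = (if b then 0 else 3) then [arrs s 0] else []) @ [] =
      (if b \<and> c = 0 then [arrs s 0] else [])" using c by auto
  ultimately have "reach B s t (if b \<and> c = 0 then [arrs s 0] else []) step_cost"
    using s B by (intro reach_step) (simp_all add: rep_def)
  with t(2) show ?thesis by blast
qed

lemma reach_ascend: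
  assumes y: "y \<in> codes n k" and s: "rep n y 3 b s" and le: "first_nz n y \<le> n"
  shows "\<exists>t. reach B s t (if b then [] else [arrs s 0]) step_cost \<and>
    rep n (up (first_nz n y) y) (kind n y + 1) (\<not> b) t"
proof -
  from run_ascend[OF y s le] obtain t where t: "run B ascend s = Some (t, [])"
    "rep n (up (first_nz n y) y) (kind n y + 1) (\<not> b) t" by blast
  have e: "eval B s (Bin Less (Reg 2) (Const 3)) = Some 0" using eval_dispatch[OF s] by simp
  have "run B body s = Some (t, (if 3 = (if b then 0 else 3 :: nat) then [arrs s 0] else []) @ [])"
    unfolding body_def by (rule run_Seq[OF run_emit[OF s] run_Cond_False[OF e t(1)]]) simp
  then have "reach B s t (if b then [] else [arrs s 0]) step_cost"
    using s B by (intro reach_step) (simp_all add: rep_def split: if_splits)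
  with t(2) show ?thesis by blast
qed

text \<open>An iteration is spent on each of the values 0, ..., 3 of the child counter of each visited
  code; only the last one, which leaves the subtree of \<open>x\<close>, is not counted here.\<close>

lemma reach_walk:
  assumes "x \<in> codes n k" "n * k < weight n x + m" "rep n x 0 b s"
  shows "\<exists>t outs. reach B s t outs (step_cost * (4 * length (walk (children n) m b x) - 1)) \<and> rep n x 3 b t \<and>
    list_all2 (stores_perm n) (outs @ (if b then [] else [arrs t 0])) (map (decode n) (walk (children n) m b x))"
  using assms
proof (induction m arbitrary: x b s)
  case 0
  then show ?case using weight_le[of x n k] by simp
next
  case (Suc m)
  note x = Suc.prems(1)
  define w where "w c = (if valid n x (cand n x c) then walk (children n) m (\<not> b) (dn (cand n x c) x) else [])" for c
  have child: "\<exists>t outs. reach B s t outs (step_cost * (1 + 4 * length (w c))) \<and> rep n x (c + 1) b t \<and>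
      list_all2 (stores_perm n) outs (map (decode n) ((if b \<and> c = 0 then [x] else []) @ w c))"
    if c: "c < 3" and s: "rep n x c b s" for c s
  proof -
    from reach_descend[OF x s c] obtain s1 where
      s1: "reach B s s1 (if b \<and> c = 0 then [arrs s 0] else []) step_cost"
        "if valid n x (cand n x c) then rep n (dn (cand n x c) x) 0 (\<not> b) s1 else rep n x (c + 1) b s1"
      by blast
    have out: "list_all2 (stores_perm n) (if b \<and> c = 0 then [arrs s 0] else [])
        (map (decode n) (if b \<and> c = 0 then [x] else []))"
      using s by (simp add: rep_def)
    show ?thesis
    proof (cases "valid n x (cand n x c)")
      case False
      then have "reach B s s1 (if b \<and> c = 0 then [arrs s 0] else []) (step_cost * (1 + 4 * length (w c)))"
        "w c = []" "rep n x (c + 1) b s1"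
        using s1 by (simp_all add: w_def)
      then show ?thesis
        using out by (intro exI[of _ s1] exI[of _ "if b \<and> c = 0 then [arrs s 0] else []"]) simp
    next
      case True
      define y where "y = dn (cand n x c) x"
      note sh = dn_shape[OF x n c True, folded y_def]
      have pos: "0 < x (cand n x c - 1)" and ln: "cand n x c \<le> n" using True by (simp_all add: valid_def)
      have up: "up (first_nz n y) y = x"
        unfolding sh(4) unfolding y_def by (rule up_dn[where x = x, OF sh(1) pos])
      have wy: "weight n y = Suc (weight n x)"
        unfolding y_def by (rule dn_weight[where x = x, OF sh(1) ln pos])
      have le: "first_nz n y \<le> n" using ln sh(4) by simp
      \<comment> \<open>The index of the child is recomputed from its code on the way back; as the
        candidates are distinct, it is the \<open>c\<close> with which the child was
        entered.\<close>
      have "cand n x (kind n y) = cand n x c"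
        using up_shape(8)[OF sh(2) n le] up sh(4) by simp
      then have kind: "kind n y = c"
        using c first_nz(1)[OF x n] by (auto simp: cand_def kind_def split: if_splits)
      have wc: "w c = walk (children n) m (\<not> b) y" using True by (simp add: w_def y_def)
      have "n * k < weight n y + m" "rep n y 0 (\<not> b) s1" using Suc.prems(2) wy s1(2) True by (simp_all add: y_def)
      from Suc.IH[OF sh(2) this] obtain s2 outs where
        s2: "reach B s1 s2 outs (step_cost * (4 * length (w c) - 1))" "rep n y 3 (\<not> b) s2"
        "list_all2 (stores_perm n) (outs @ (if \<not> b then [] else [arrs s2 0])) (map (decode n) (w c))"
        unfolding wc by blast
      from reach_ascend[OF sh(2) s2(2) le] obtain s3 where
        s3: "reach B s2 s3 (if \<not> b then [] else [arrs s2 0]) step_cost" "rep n x (c + 1) b s3"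
        by (auto simp: up kind)
      have "w c \<noteq> []"
        unfolding wc using weight_le[OF sh(2)] \<open>n * k < weight n y + m\<close> by (cases m) (simp_all add: Let_def)
      then have "0 < 4 * length (w c)" by simp
      \<comment> \<open>One iteration enters the child and one leaves it; the latter is the one
        missing from the child's own count.\<close>
      then have cost: "step_cost + (step_cost * (4 * length (w c) - 1) + step_cost) = step_cost * (1 + 4 * length (w c))"
        by (cases "4 * length (w c)") simp_all
      have "reach B s s3 ((if b \<and> c = 0 then [arrs s 0] else []) @ outs @ (if \<not> b then [] else [arrs s2 0]))
          (step_cost * (1 + 4 * length (w c)))"
        using reach_trans[OF s1(1) reach_trans[OF s2(1) s3(1)]] unfolding cost .
      moreover have "list_all2 (stores_perm n)
          ((if b \<and> c = 0 then [arrs s 0] else []) @ outs @ (if \<not> b then [] else [arrs s2 0]))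
          (map (decode n) ((if b \<and> c = 0 then [x] else []) @ w c))"
        unfolding map_append by (rule list_all2_appendI[OF out s2(3)])
      ultimately show ?thesis using s3(2) by blast
    qed
  qed
  have lt: "(0 :: nat) < 3" "(1 :: nat) < 3" "(2 :: nat) < 3" by simp_all
  from child[OF lt(1) Suc.prems(3)] obtain s1 o1 where
    1: "reach B s s1 o1 (step_cost * (1 + 4 * length (w 0)))" "rep n x (0 + 1) b s1"
      "list_all2 (stores_perm n) o1 (map (decode n) ((if b \<and> (0 :: nat) = 0 then [x] else []) @ w 0))"
    by blast
  from 1(2) have "rep n x 1 b s1" by (simp only: add_0)
  from child[OF lt(2) this] obtain s2 o2 where
    2: "reach B s1 s2 o2 (step_cost * (1 + 4 * length (w 1)))" "rep n x (1 + 1) b s2"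
      "list_all2 (stores_perm n) o2 (map (decode n) ((if b \<and> (1 :: nat) = 0 then [x] else []) @ w 1))"
    by blast
  from 2(2) have "rep n x 2 b s2" by (simp only: one_add_one)
  from child[OF lt(3) this] obtain s3 o3 where
    3: "reach B s2 s3 o3 (step_cost * (1 + 4 * length (w 2)))" "rep n x (2 + 1) b s3"
      "list_all2 (stores_perm n) o3 (map (decode n) ((if b \<and> (2 :: nat) = 0 then [x] else []) @ w 2))"
    by blast
  from 3(2) have s3: "rep n x 3 b s3" by simp
  have walk: "walk (children n) (Suc m) b x =
      (if b then [x] else []) @ w 0 @ w 1 @ w 2 @ (if b then [] else [x])"
    by (simp add: children_def w_def Let_def)
  \<comment> \<open>Three iterations at \<open>x\<close> and four for each code below it: four per
    code of the whole list, less the one that leaves \<open>x\<close>.\<close>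
  have "step_cost * (1 + 4 * length (w 0)) + (step_cost * (1 + 4 * length (w 1)) + step_cost * (1 + 4 * length (w 2)))
      = step_cost * (4 * length (walk (children n) (Suc m) b x) - 1)"
    unfolding walk add_mult_distrib2[symmetric] by (rule arg_cong[where f = "\<lambda>a. step_cost * a"]) simp
  with reach_trans[OF 1(1) reach_trans[OF 2(1) 3(1)]]
  have "reach B s s3 (o1 @ o2 @ o3) (step_cost * (4 * length (walk (children n) (Suc m) b x) - 1))"
    by (simp only:)
  moreover have "list_all2 (stores_perm n) ((o1 @ o2 @ o3) @ (if b then [] else [arrs s3 0]))
      (map (decode n) (walk (children n) (Suc m) b x))"
  proof -
    have "list_all2 (stores_perm n) (if b then [] else [arrs s3 0]) (map (decode n) (if b then [] else [x]))"
      using s3 by (simp add: rep_def)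
    from list_all2_appendI[OF 1(3) list_all2_appendI[OF 2(3) list_all2_appendI[OF 3(3) this]]]
    show ?thesis unfolding walk by simp
  qed
  ultimately show ?case using s3 by blast
qed

end

section \<open>The root code and its initialization\<close>

definition root_code :: "nat \<Rightarrow> nat \<Rightarrow> nat \<Rightarrow> nat" where
  "root_code N s i = (if i \<le> Suc N then i - 1 else if i = N + 2 then s else 0)"

text \<open>\<open>N\<close> belongs to the largest triangular number not above \<open>k\<close>. As
  \<open>k\<close> is at most the triangular number of \<open>n - 1\<close>, no remainder falls on
  place \<open>n + 1\<close>, which does not exist.\<close>

lemma triangular_decomp:
  assumes "1 \<le> n" "k \<le> n * (n - 1) div 2"
  obtains N s where "k = \<Sum>{0..N} + s" "s \<le> N" "Suc N \<le> n" "Suc N = n \<Longrightarrow> s = 0"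
proof -
  have "\<exists>N s. k = \<Sum>{0..N} + s \<and> s \<le> N"
  proof (induction k)
    case 0
    show ?case by (intro exI[of _ 0]) simp
  next
    case (Suc k)
    then obtain N s where N: "k = \<Sum>{0..N} + s" "s \<le> N" by blast
    show ?case
    proof (cases "s = N")
      case True
      then show ?thesis using N by (intro exI[of _ "Suc N"] exI[of _ 0]) simp
    next
      case False
      then show ?thesis using N by (intro exI[of _ N] exI[of _ "Suc s"]) simp
    qed
  qed
  then obtain N s where N: "k = \<Sum>{0..N} + s" "s \<le> N" by blast
  obtain m where m: "n = Suc m" using assms(1) by (cases n) simp_all
  have le: "k \<le> \<Sum>{0..m}" using assms(2) gauss_sum_nat[of m] by (simp add: m mult.commute)
  have "N \<le> m"
  proof (rule ccontr)
    assume "\<not> N \<le> m"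
    then have "\<Sum>{0..Suc m} \<le> \<Sum>{0..N}" by (intro sum_mono2) auto
    then show False using le N(1) by simp
  qed
  moreover have "s = 0" if "N = m" using le N(1) that by simp
  ultimately show thesis using that[OF N] m by simp
qed

lemma root_code:
  assumes "s \<le> N" "Suc N \<le> n" "Suc N = n \<Longrightarrow> s = 0"
  shows "root_code N s \<in> codes n (\<Sum>{0..N} + s)" "full_upto (root_code N s) = Suc N"
    "first_nz n (root_code N s) = n + 2"
proof -
  show f: "full_upto (root_code N s) = Suc N"
    by (rule full_upto_eq) (use assms(1) in \<open>auto simp: root_code_def\<close>)
  show "first_nz n (root_code N s) = n + 2"
    unfolding first_nz_def f by (rule next_nz_eq) (use assms(2) in \<open>auto simp: root_code_def\<close>)
  have sum: "(\<Sum>i\<le>m. root_code N s i) = (if m \<le> Suc N then \<Sum>{0..m - 1} else \<Sum>{0..N} + s)" for m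
  proof (induction m)
    case 0
    show ?case by (simp add: root_code_def)
  next
    case (Suc m)
    then show ?case by (cases m) (auto simp: root_code_def)
  qed
  have "(\<Sum>i\<le>n. root_code N s i) = \<Sum>{0..N} + s"
    unfolding sum using assms by (auto simp: le_Suc_eq)
  moreover have "root_code N s i \<le> i - 1" for i using assms(1) by (simp add: root_code_def)
  moreover have "root_code N s i = 0" if "n < i" for i
    using assms that by (cases "Suc N = n") (auto simp: root_code_def)
  ultimately show "root_code N s \<in> codes n (\<Sum>{0..N} + s)" by (simp add: codes_def)
qed

lemma decode_root:
  assumes s: "s \<le> N" "Suc N \<le> n" "Suc N = n \<Longrightarrow> s = 0" and j: "1 \<le> j" "j \<le> n"
  shows "int (decode n (root_code N s) j) =
    (if j < N + 3 then (int (Suc N) - int j - int s) mod (int (Suc N) + 1) + 1 else int j)"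
proof (cases "j < N + 3")
  case False
  have "decode n (root_code N s) = decode (N + 2) (root_code N s)"
    using False j by (intro decode_zeros) (simp_all add: root_code_def)
  moreover have "decode (N + 2) (root_code N s) j = j"
    using False by (intro decode_beyond) simp
  ultimately show ?thesis using False by (simp del: decode.simps)
next
  case True
  show ?thesis
  proof (cases "Suc N = n")
    case False
    have "int (decode n (root_code N s) j) =
      (int (Suc N) - int j - int (root_code N s (Suc (Suc N)))) mod (int (Suc N) + 1) + 1"
      using s(1,2) j True False by (intro decode_full_partial) (simp_all add: root_code_def)
    then show ?thesis using True by (simp add: root_code_def)
  next
    case full: True
    then have "decode n (root_code N s) j = n + 1 - j"
      using j by (intro decode_full) (auto simp: root_code_def)
    \<comment> \<open>Without a partial entry the permutation is the plain reversal. The modulus is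
      now \<open>n + 1\<close> and exceeds every offset, so the same formula stays right.\<close>
    moreover have "(int n - int j) mod (int n + 1) = int n - int j"
      using j by (intro mod_pos_pos_trivial) auto
    ultimately show ?thesis using full s(3) True j by auto
  qed
qed

definition init1 :: com where
  "init1 = Assign 4 (Const 1)"

text \<open>Subtracting 1, 2, 3, ... from \<open>k\<close> as long as possible finds
  \<open>N\<close> in linear time and leaves \<open>s\<close> in register 1.\<close>

definition fill_guard :: expr where
  "fill_guard = Bin Less (Reg 4) (Bin Add (Reg 1) (Const 1))"

definition fill_body :: com where
  "fill_body = Seq (Assign 1 (Bin Sub (Reg 1) (Reg 4)))
     (Seq (Store 1 (Bin Add (Reg 4) (Const 1)) (Reg 4)) (Assign 4 (Bin Add (Reg 4) (Const 1))))"

definition init2 :: com where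
  "init2 = Seq (Store 1 (Bin Add (Reg 4) (Const 1)) (Reg 1)) (Assign 7 (Const 1))"

definition perm_guard :: expr where
  "perm_guard = Bin Less (Reg 7) (Bin Add (Reg 0) (Const 1))"

text \<open>The offset may be negative; its remainder modulo a positive number is nonnegative all
  the same.\<close>

definition perm_body :: com where
  "perm_body = Seq (Cond (Bin Less (Reg 7) (Bin Add (Reg 4) (Const 2)))
       (Store 0 (Reg 7) (Bin Add (Bin Mod (Bin Sub (Bin Sub (Reg 4) (Reg 7)) (Reg 1))
                                          (Bin Add (Reg 4) (Const 1))) (Const 1)))
       (Store 0 (Reg 7) (Reg 7)))
     (Assign 7 (Bin Add (Reg 7) (Const 1)))"

definition init3 :: com where
  "init3 = Seq (Assign 5 (Bin Add (Reg 0) (Const 2))) (Assign 6 (Const 1))"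

definition program :: com where
  "program = Seq init1 (Seq (While fill_guard fill_body) (Seq init2
     (Seq (While perm_guard perm_body) (Seq init3 main_loop))))"

definition init_cost :: nat where
  "init_cost = cost_bound init1 + (1 + ecost fill_guard + cost_bound fill_body) + cost_bound init2 +
     (1 + ecost perm_guard + cost_bound perm_body) + cost_bound init3"

context machine
begin

lemma exec_main_loop:
  assumes r: "r \<in> codes n k" "first_nz n r = n + 2" and s: "rep n r 0 True s"
  defines "w \<equiv> walk (children n) (Suc (n * k)) True r"
  shows "\<exists>t outs m. exec B main_loop s t outs m \<and> list_all2 (stores_perm n) outs (map (decode n) w) \<and>
    m \<le> step_cost * (4 * length w) + 2"
proof -
  have "n * k < weight n r + Suc (n * k)" by simp
  from reach_walk[OF r(1) this s] obtain s1 outs where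
    s1: "reach B s s1 outs (step_cost * (4 * length w - 1))" "rep n r 3 True s1"
      "list_all2 (stores_perm n) outs (map (decode n) w)" by (auto simp: w_def)
  have e: "eval B s1 (Bin Less (Reg 2) (Const 3)) = Some 0" using eval_dispatch[OF s1(2)] by simp
  have "run B body s1 = Some (set_reg 6 0 s1, (if 3 = (if True then 0 else 3 :: nat) then [arrs s1 0] else []) @ [])"
    unfolding body_def
    by (rule run_Seq[OF run_emit[OF s1(2)] run_Cond_False[OF e run_ascend_root[OF r(1) s1(2) r(2)]]]) simp
  then have "run B body s1 = Some (set_reg 6 0 s1, [])" by simp
  then have "reach B s1 (set_reg 6 0 s1) [] step_cost"
    using s1(2) B by (intro reach_step) (simp_all add: rep_def)
  from reach_trans[OF s1(1) this] obtain m where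
    m: "m \<le> step_cost * (4 * length w - 1) + step_cost"
      "\<And>t outs' m'. exec B main_loop (set_reg 6 0 s1) t outs' m' \<Longrightarrow> exec B main_loop s t ((outs @ []) @ outs') (m + m')"
    unfolding reach_def by blast
  have "eval B (set_reg 6 0 s1) (Reg 6) = Some 0" using B by (simp add: fits_Some)
  from exec.WhileFalse[OF this] have "exec B main_loop (set_reg 6 0 s1) (set_reg 6 0 s1) [] 2"
    unfolding main_loop_def by (simp add: numeral_2_eq_2)
  from m(2)[OF this] have "exec B main_loop s (set_reg 6 0 s1) outs (m + 2)" by simp
  \<comment> \<open>The iteration left out by \<open>reach_walk\<close> is the one at the root with
    counter 3, which clears the loop flag. The additional 2 is the last evaluation of the
    guard.\<close>
  moreover have "0 < 4 * length w" by (simp add: w_def)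
  then have "step_cost * (4 * length w - 1) + step_cost = step_cost * (4 * length w)"
    by (cases "4 * length w") simp_all
  ultimately show ?thesis using s1(3) m(1) by (intro exI conjI) auto
qed

lemma exec_init:
  assumes k: "k = \<Sum>{0..N} + s" and s: "s \<le> N" "Suc N \<le> n" "Suc N = n \<Longrightarrow> s = 0" and kB: "int k + 1 \<le> B"
  shows "\<exists>st m. (\<forall>t outs m'. exec B main_loop st t outs m' \<longrightarrow> exec B program (init_state n k) t outs (m + m')) \<and>
    rep n (root_code N s) 0 True st \<and> m \<le> (n + 1) * init_cost"
proof -
  define r where "r = root_code N s"
  note root = root_code[OF s, folded r_def]
  define T where "T i = \<Sum>{0..i}" for i :: nat
  have kT: "k = T N + s" and T: "T 0 = 0" "\<And>i. T (Suc i) = T i + Suc i"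
    using k by (simp_all add: T_def)
  define I where "I i st \<longleftrightarrow> regs st 0 = int n \<and> regs st 1 = int k - int (T i) \<and> regs st 2 = 0 \<and> regs st 3 = 0 \<and>
    regs st 4 = int i + 1 \<and> arrs st 1 = (\<lambda>j. if j \<le> Suc i then int (j - 1) else 0)"
    for i and st :: state
  define J where "J i st \<longleftrightarrow> regs st 0 = int n \<and> regs st 1 = int s \<and> regs st 2 = 0 \<and> regs st 3 = 0 \<and>
    regs st 4 = int N + 1 \<and> regs st 7 = int i + 1 \<and> arrs st 1 = (\<lambda>j. int (r j)) \<and>
    (\<forall>j\<in>{1..i}. arrs st 0 j = int (decode n r j))"
    for i and st :: state
  have "run B init1 (init_state n k) = Some (set_reg 4 1 (init_state n k), [])"
    using B by (simp add: init1_def fits_Some)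
  from run_exec[OF this] obtain m1 where m1: "m1 \<le> cost_bound init1"
    "exec B init1 (init_state n k) (set_reg 4 1 (init_state n k)) [] m1" by blast
  have "I 0 (set_reg 4 1 (init_state n k))"
    by (auto simp: I_def init_state_def fun_eq_iff T)
  have "\<exists>st2 m2. exec B (While fill_guard fill_body) (set_reg 4 1 (init_state n k)) st2 [] m2 \<and> I N st2 \<and>
      m2 \<le> (N - 0 + 1) * (1 + ecost fill_guard + cost_bound fill_body)"
  proof (rule while_count[where I = I])
    fix i st assume st: "I i st" "i < N"
    have "T (Suc i) \<le> T N" unfolding T_def using st(2) by (intro sum_mono2) auto
    then have le: "int (T i) + int i + 1 \<le> int k" using kT T by simp
    have bounds: "int i + 2 \<le> B" "int k - int (T i) + 1 \<le> B" "1 \<le> B"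
      using st(2) s(2) B kB by auto
    have "eval B st fill_guard = Some 1"
      using st(1) le bounds by (simp add: fill_guard_def I_def fits_Some)
    moreover let ?t = "set_reg 4 (2 + int i) (set_cell 1 (Suc (Suc i)) (int i + 1)
       (set_reg 1 (int k - int (T i) - (int i + 1)) st))"
    have nat: "nat (2 + int i) = Suc (Suc i)" by simp
    have "run B fill_body st = Some (?t, [])"
      using st(1) le bounds nat by (simp add: fill_body_def I_def fits_Some)
    moreover have "I (Suc i) ?t"
      using st(1) unfolding I_def by (auto simp: fun_eq_iff T)
    ultimately show "\<exists>v s'. eval B st fill_guard = Some v \<and> v \<noteq> 0 \<and> run B fill_body st = Some (s', []) \<and> I (Suc i) s'"
      by fastforce
  next
    fix st assume st: "I N st"
    have "regs st 1 = int s" using st kT by (simp add: I_def)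
    then show "eval B st fill_guard = Some 0"
      using st s B by (simp add: fill_guard_def I_def fits_Some)
  qed (use \<open>I 0 _\<close> in simp_all)
  then obtain s2 m2 where s2: "exec B (While fill_guard fill_body) (set_reg 4 1 (init_state n k)) s2 [] m2" "I N s2"
    "m2 \<le> (N + 1) * (1 + ecost fill_guard + cost_bound fill_body)" by auto
  have reg1: "regs s2 1 = int s" using s2(2) kT by (simp add: I_def)
  define s3 where "s3 = set_reg 7 1 (set_cell 1 (N + 2) (int s) s2)"
  have nat: "nat (2 + int N) = N + 2" by simp
  have "run B init2 s2 = Some (s3, [])"
    using s2(2) reg1 s B nat by (simp add: init2_def I_def fits_Some s3_def)
  from run_exec[OF this] obtain m3 where m3: "m3 \<le> cost_bound init2" "exec B init2 s2 s3 [] m3" by blast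
  have "J 0 s3"
    using s2(2) reg1 by (auto simp: J_def I_def s3_def fun_eq_iff r_def root_code_def)
  have "\<exists>s4 m4. exec B (While perm_guard perm_body) s3 s4 [] m4 \<and> J n s4 \<and>
      m4 \<le> (n - 0 + 1) * (1 + ecost perm_guard + cost_bound perm_body)"
  proof (rule while_count[where I = J])
    fix i st assume st: "J i st" "i < n"
    define v where "v = (if i + 1 < N + 3 then (int N - int i - int s) mod (2 + int N) + 1 else int i + 1)"
    have dec: "v = int (decode n r (Suc i))"
      using decode_root[OF s, of "Suc i"] st(2) by (simp add: v_def r_def algebra_simps)
    have bounds: "int i + 2 \<le> B" "int n + 1 \<le> B" "int N + 3 \<le> B" "int N + int i + int s + 2 \<le> B" "1 \<le> B" "int s \<le> B"
      using st(2) s B by auto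
    have mod: "fits B (z mod (2 + int N)) = Some (z mod (2 + int N))"
      "fits B (z mod (2 + int N) + 1) = Some (z mod (2 + int N) + 1)" for z
    proof -
      have "0 \<le> z mod (2 + int N)" "z mod (2 + int N) < 2 + int N" by simp_all
      then have "\<bar>z mod (2 + int N)\<bar> \<le> B" "\<bar>z mod (2 + int N) + 1\<bar> \<le> B"
        using bounds by linarith+
      from this[THEN fits_Some]
      show "fits B (z mod (2 + int N)) = Some (z mod (2 + int N))"
        "fits B (z mod (2 + int N) + 1) = Some (z mod (2 + int N) + 1)" by this
    qed
    have "eval B st perm_guard = Some 1"
      using st bounds by (simp add: perm_guard_def J_def fits_Some)
    moreover let ?t = "set_reg 7 (2 + int i) (set_cell 0 (Suc i) v st)"
    have "run B (Cond (Bin Less (Reg 7) (Bin Add (Reg 4) (Const 2)))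
       (Store 0 (Reg 7) (Bin Add (Bin Mod (Bin Sub (Bin Sub (Reg 4) (Reg 7)) (Reg 1))
                                          (Bin Add (Reg 4) (Const 1))) (Const 1)))
       (Store 0 (Reg 7) (Reg 7))) st = Some (set_cell 0 (Suc i) v st, [])"
      using st(1) bounds unfolding v_def by (simp add: J_def fits_Some nat_int_succ mod)
    then have "run B perm_body st = Some (?t, [] @ [])"
      unfolding perm_body_def by (rule run_Seq) (use st(1) bounds in \<open>simp add: J_def fits_Some\<close>)
    moreover have "J (Suc i) ?t"
      using st(1) dec unfolding J_def by (auto simp: le_Suc_eq)
    ultimately show "\<exists>v s'. eval B st perm_guard = Some v \<and> v \<noteq> 0 \<and> run B perm_body st = Some (s', []) \<and> J (Suc i) s'"
      by fastforce
  next
    fix st assume "J n st"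
    then show "eval B st perm_guard = Some 0"
      using B by (simp add: perm_guard_def J_def fits_Some)
  qed (use \<open>J 0 s3\<close> in simp_all)
  then obtain s4 m4 where s4: "exec B (While perm_guard perm_body) s3 s4 [] m4" "J n s4"
    "m4 \<le> (n + 1) * (1 + ecost perm_guard + cost_bound perm_body)" by auto
  define s5 where "s5 = set_reg 6 1 (set_reg 5 (int n + 2) s4)"
  have "run B init3 s4 = Some (s5, [])"
    using s4(2) B by (simp add: init3_def J_def fits_Some s5_def)
  from run_exec[OF this] obtain m5 where m5: "m5 \<le> cost_bound init3" "exec B init3 s4 s5 [] m5" by blast
  have "exec B program (init_state n k) t outs ((m1 + (m2 + (m3 + (m4 + m5)))) + m')"
    if "exec B main_loop s5 t outs m'" for t outs m'
    using exec.Seq[OF m1(2) exec.Seq[OF s2(1) exec.Seq[OF m3(2) exec.Seq[OF s4(1) exec.Seq[OF m5(2) that]]]]]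
    by (simp add: program_def add.assoc)
  moreover have "rep n r 0 True s5"
  proof -
    \<comment> \<open>The root has no entry in the linked range, so the links need no
      initialization.\<close>
    have "r i = 0" if "Suc N + 2 \<le> i" for i using that by (simp add: r_def root_code_def)
    then have "linked n r A" for A by (simp add: linked_def root(2))
    then show ?thesis
      using s4(2) root(2,3) by (simp add: rep_def J_def s5_def stores_perm_def)
  qed
  moreover have "m1 + (m2 + (m3 + (m4 + m5))) \<le> (n + 1) * init_cost"
  proof -
    have "(N + 1) * a \<le> (n + 1) * a" for a using s(2) by (intro mult_le_mono) simp_all
    then have "m2 \<le> (n + 1) * (1 + ecost fill_guard + cost_bound fill_body)"
      using s2(3) order_trans by blast
    moreover have "a \<le> (n + 1) * a" for a by simp
    then have "m1 \<le> (n + 1) * cost_bound init1" "m3 \<le> (n + 1) * cost_bound init2"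
      "m5 \<le> (n + 1) * cost_bound init3" using m1(1) m3(1) m5(1) order_trans by blast+
    ultimately show ?thesis
      using s4(3) unfolding init_cost_def add_mult_distrib2 by linarith
  qed
  ultimately show ?thesis unfolding r_def by blast
qed

end

theorem mainTheorem3:
  "\<exists>(P :: com) (C :: nat) (D :: nat) (d :: nat).
     \<forall>(n :: nat) (k :: nat). 1 \<le> n \<and> k \<le> n * (n - 1) div 2 \<longrightarrow>
       (\<exists>\<pi>s m. generates (int (D * n ^ d)) P n k \<pi>s m \<and>
          distinct \<pi>s \<and>
          set \<pi>s = perms_maj n k \<and>
          successively (differ_by_transpositions n 3) \<pi>s \<and>
          m \<le> C * (card (perms_maj n k) + n ^ 2))"
proof (rule exI[of _ program], rule exI[of _ "4 * step_cost + 2 * init_cost + 2"],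
    rule exI[of _ 13], rule exI[of _ 2], intro allI impI)
  fix n k :: nat
  assume nk: "1 \<le> n \<and> k \<le> n * (n - 1) div 2"
  \<comment> \<open>13 = 3 + 10: as \<open>n\<close> and 1 are at most \<open>n ^ 2\<close>, this
    covers \<open>3 * n + 10\<close>, and also \<open>k + 1\<close>.\<close>
  let ?B = "int (13 * n ^ 2)"
  have n2: "n \<le> n ^ 2" using nk by (simp add: power2_eq_square)
  have "3 * n + 10 \<le> 13 * n ^ 2" using n2 nk by linarith
  then have "int (3 * n + 10) \<le> ?B" unfolding of_nat_le_iff .
  then interpret machine n k ?B
    using nk by unfold_locales simp_all
  obtain N s where k: "k = \<Sum>{0..N} + s" and s: "s \<le> N" "Suc N \<le> n" "Suc N = n \<Longrightarrow> s = 0"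
    using triangular_decomp[OF conjunct1[OF nk] conjunct2[OF nk]] by metis
  have "n * (n - 1) div 2 \<le> n ^ 2"
  proof -
    have "n * (n - 1) div 2 \<le> n * (n - 1)" by simp
    also have "\<dots> \<le> n ^ 2" by (simp add: power2_eq_square)
    finally show ?thesis .
  qed
  then have "k + 1 \<le> 13 * n ^ 2" using nk n2 by linarith
  then have "int (k + 1) \<le> ?B" unfolding of_nat_le_iff .
  then have kB: "int k + 1 \<le> ?B" by simp
  define r where "r = root_code N s"
  have r: "r \<in> codes n k" "first_nz n r = n + 2" using root_code[OF s] k by (simp_all add: r_def)
  let ?w = "walk (children n) (Suc (n * k)) True r"
  let ?\<pi>s = "map (decode n) ?w"
  note gray = gray_code[OF r n]
  from exec_init[OF k s kB] obtain st m0 where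
    st: "\<And>t outs m'. exec ?B main_loop st t outs m' \<Longrightarrow> exec ?B program (init_state n k) t outs (m0 + m')"
      "rep n r 0 True st" "m0 \<le> (n + 1) * init_cost"
    unfolding r_def by blast
  from exec_main_loop[OF r st(2)] obtain t outs m where
    m: "exec ?B main_loop st t outs m" "list_all2 (stores_perm n) outs ?\<pi>s"
      "m \<le> step_cost * (4 * length ?w) + 2" by blast
  have "generates ?B program n k ?\<pi>s (m0 + m)"
    unfolding generates_def using st(1)[OF m(1)] m(2) by blast
  moreover have "m0 + m \<le> (4 * step_cost + 2 * init_cost + 2) * (card (perms_maj n k) + n ^ 2)"
  proof -
    have len: "length ?w = card (perms_maj n k)"
      using distinct_card[OF gray(1)] gray(2) by simp
    \<comment> \<open>Four iterations per code give \<open>4 * step_cost\<close>, this estimate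
      turns the linear initialization into \<open>2 * init_cost\<close>, and the final guard
      accounts for the 2.\<close>
    have "n + 1 \<le> 2 * n ^ 2" "1 \<le> n ^ 2" using n2 nk by linarith+
    then have "m0 \<le> (2 * n ^ 2) * init_cost" using st(3) by (meson mult_le_mono1 order_trans)
    then have "m0 + m \<le> 4 * step_cost * card (perms_maj n k) + (2 * init_cost + 2) * n ^ 2"
      using m(3) \<open>1 \<le> n ^ 2\<close> unfolding len by (simp add: algebra_simps)
    also have "\<dots> \<le> (4 * step_cost + 2 * init_cost + 2) * (card (perms_maj n k) + n ^ 2)"
      by (simp add: algebra_simps)
    finally show ?thesis .
  qed
  ultimately show "\<exists>\<pi>s m. generates ?B program n k \<pi>s m \<and> distinct \<pi>s \<and> set \<pi>s = perms_maj n k \<and>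
      successively (differ_by_transpositions n 3) \<pi>s \<and>
      m \<le> (4 * step_cost + 2 * init_cost + 2) * (card (perms_maj n k) + n ^ 2)"
    using gray by blast
qed

end
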